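(* Let $p$ be a prime and $n\in\mathbb N$. Then $AT(\mathbb Q_p^n)$ holds; that is, for every continuous endomorphism $\phi$ of the topological group $\mathbb Q_p^n$ and every closed subgroup $H$ of $\mathbb Q_p^n$ with $\phi(H)\subseteq H$, $$h_{top}(\phi)=h_{top}(\phi\restriction_H)+h_{top}(\bar\phi),$$ where $\bar\phi$ is the continuous endomorphism of $\mathbb Q_p^n/H$ induced by $\phi$.
   Context: For a locally compact group $G$ with left Haar measure $\mu$, let $\mathcal C(G)$ be the family of compact neighborhoods of the identity. For a continuous endomorphism $\phi$ of $G$, $U\in\mathcal C(G)$ and $n\ge 1$ put $C_n(\phi,U)=U\cap\phi^{-1}(U)\cap\dots\cap\phi^{-n+1}(U)$, $H_{top}(\phi,U)=\limsup_{n\to\infty}\frac{-\log\mu(C_n(\phi,U))}{n}$, and $h_{top}(\phi)=\sup\{H_{top}(\phi,U)\mid U\in\mathcal C(G)\}\in[0,\infty]$ (topological entropy). $\mathbb Q_p$ carries its usual $p$-adic topology and $\mathbb Q_p^n$ the product topology. *)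

theory Defs
  imports
    "HOL-Analysis.Analysis"
    "HOL-Algebra.Product_Groups"
    "Berlekamp_Zassenhaus.Finite_Field"
begin

section \<open>The p-adic numbers\<close>

text \<open>
  The prime \<open>p\<close> is the cardinality of a type of class \<^class>\<open>prime_card\<close>, and the p-adic numbers
  are the completion of the rationals, by Cauchy sequences, for the p-adic absolute value.
\<close>

definition padic_abs :: "nat \<Rightarrow> rat \<Rightarrow> real" where
  "padic_abs p x = (if x = 0 then 0
     else real p powi (int (multiplicity (int p) (snd (quotient_of x)))
                       - int (multiplicity (int p) (fst (quotient_of x)))))"

definition padic_cauchy :: "nat \<Rightarrow> (nat \<Rightarrow> rat) \<Rightarrow> bool" where
  "padic_cauchy p X \<longleftrightarrow> (\<forall>e>0. \<exists>N. \<forall>m\<ge>N. \<forall>n\<ge>N. padic_abs p (X m - X n) < e)"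

lemma padic_abs_0 [simp]: "padic_abs p 0 = 0"
  by (simp add: padic_abs_def)

lemma padic_abs_nonneg [simp]: "padic_abs p x \<ge> 0"
  by (simp add: padic_abs_def)

lemma padic_abs_fraction:
  assumes p: "prime p" and a: "a \<noteq> 0" and b: "b \<noteq> 0"
  shows "padic_abs p (of_int a / of_int b)
           = real p powi (int (multiplicity (int p) b) - int (multiplicity (int p) a))"
proof -
  define x :: rat where "x = of_int a / of_int b"
  obtain c d where cd: "quotient_of x = (c, d)"
    by (cases "quotient_of x")
  have d: "d > 0"
    using quotient_of_denom_pos[OF cd] .
  have x: "x = of_int c / of_int d"
    using quotient_of_div[OF cd] .
  have x0: "x \<noteq> 0"
    using a b by (simp add: x_def)
  have c: "c \<noteq> 0"
    using x x0 by auto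
  have "(of_int (a * d) :: rat) = of_int (c * b)"
    using x b d by (simp add: x_def field_simps)
  then have "a * d = c * b"
    by (simp only: of_int_eq_iff)
  then have "multiplicity (int p) (a * d) = multiplicity (int p) (c * b)"
    by simp
  moreover have "prime_elem (int p)"
    using p by simp
  ultimately have "multiplicity (int p) a + multiplicity (int p) d
      = multiplicity (int p) c + multiplicity (int p) b"
    using a b c d by (simp add: prime_elem_multiplicity_mult_distrib)
  then have "int (multiplicity (int p) b) - int (multiplicity (int p) a)
      = int (multiplicity (int p) d) - int (multiplicity (int p) c)"
    by linarith
  then show ?thesis
    using x0 cd by (simp add: padic_abs_def flip: x_def)
qed

lemma padic_abs_eq_0_iff [simp]: "prime p \<Longrightarrow> padic_abs p x = 0 \<longleftrightarrow> x = 0"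
  using prime_gt_0_nat[of p] by (auto simp: padic_abs_def)

lemma padic_abs_minus [simp]: "prime p \<Longrightarrow> padic_abs p (- x) = padic_abs p x"
proof (cases "x = 0")
  case False
  assume p: "prime p"
  obtain a b where ab: "quotient_of x = (a, b)"
    by (cases "quotient_of x")
  have b: "b > 0" and x: "x = of_int a / of_int b"
    using quotient_of_denom_pos[OF ab] quotient_of_div[OF ab] .
  have a: "a \<noteq> 0"
    using False x by auto
  have "- x = of_int (- a) / of_int b"
    by (simp add: x)
  then have "padic_abs p (- x) = real p powi (int (multiplicity (int p) b) - int (multiplicity (int p) (- a)))"
    using padic_abs_fraction[OF p, of "- a" b] a b by simp
  also have "\<dots> = padic_abs p x"
    using padic_abs_fraction[OF p, of a b] a b by (simp add: x multiplicity_def)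
  finally show ?thesis .
qed simp

lemma padic_abs_minus_commute: "prime p \<Longrightarrow> padic_abs p (x - y) = padic_abs p (y - x)"
  using padic_abs_minus[of p "x - y"] by simp

lemma padic_abs_ultrametric:
  assumes p: "prime p"
  shows "padic_abs p (x + y) \<le> max (padic_abs p x) (padic_abs p y)"
proof (cases "x = 0 \<or> y = 0 \<or> x + y = 0")
  case True
  then show ?thesis
    by (auto simp: le_max_iff_disj)
next
  case False
  obtain a b where ab: "quotient_of x = (a, b)"
    by (cases "quotient_of x")
  obtain c d where cd: "quotient_of y = (c, d)"
    by (cases "quotient_of y")
  have b: "b > 0" and x: "x = of_int a / of_int b"
    using quotient_of_denom_pos[OF ab] quotient_of_div[OF ab] .
  have d: "d > 0" and y: "y = of_int c / of_int d"
    using quotient_of_denom_pos[OF cd] quotient_of_div[OF cd] .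
  let ?v = "multiplicity (int p)"
  have x': "x = of_int (a * d) / of_int (b * d)" and y': "y = of_int (c * b) / of_int (b * d)"
    and xy: "x + y = of_int (a * d + c * b) / of_int (b * d)"
    using b d by (auto simp: x y field_simps)
  have "a * d + c * b \<noteq> 0"
  proof
    assume "a * d + c * b = 0"
    then show False
      using False unfolding xy by (simp only: of_int_0 div_0) simp
  qed
  then have nz: "a * d \<noteq> 0" "c * b \<noteq> 0" "a * d + c * b \<noteq> 0" "b * d \<noteq> 0"
    using False b d x y by auto
  have "int p ^ min (?v (a * d)) (?v (c * b)) dvd a * d + c * b"
    by (intro dvd_add multiplicity_dvd') auto
  then have "min (?v (a * d)) (?v (c * b)) \<le> ?v (a * d + c * b)"
    using nz p by (intro multiplicity_geI) (auto simp: prime_gt_1_nat)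
  moreover have "real p \<ge> 1"
    using prime_gt_0_nat[OF p] by simp
  ultimately show ?thesis
    unfolding xy unfolding x' y' using nz p
    by (subst (1 2 3) padic_abs_fraction)
       (auto simp: le_max_iff_disj min_le_iff_disj intro!: power_int_increasing)
qed

lemma padic_abs_triangle: "prime p \<Longrightarrow> padic_abs p (x + y) \<le> padic_abs p x + padic_abs p y"
  using padic_abs_ultrametric[of p x y] padic_abs_nonneg[of p x] padic_abs_nonneg[of p y]
  by linarith

lemma padic_abs_triangle_diff:
  "prime p \<Longrightarrow> \<bar>padic_abs p x - padic_abs p y\<bar> \<le> padic_abs p (x - y)"
  using padic_abs_triangle[of p "x - y" y] padic_abs_triangle[of p "y - x" x]
    padic_abs_minus_commute[of p x y] by auto

lemma padic_cauchy_const: "padic_cauchy p (\<lambda>_. x)"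
  by (simp add: padic_cauchy_def)

lemma padic_cauchy_add:
  assumes p: "prime p" and X: "padic_cauchy p X" and Y: "padic_cauchy p Y"
  shows "padic_cauchy p (\<lambda>k. X k + Y k)"
  unfolding padic_cauchy_def
proof (intro allI impI)
  fix e :: real
  assume "e > 0"
  then obtain M N where M: "\<forall>m\<ge>M. \<forall>n\<ge>M. padic_abs p (X m - X n) < e"
    and N: "\<forall>m\<ge>N. \<forall>n\<ge>N. padic_abs p (Y m - Y n) < e"
    using X Y unfolding padic_cauchy_def by blast
  have "padic_abs p (X m + Y m - (X n + Y n)) < e" if "m \<ge> max M N" "n \<ge> max M N" for m n
    using padic_abs_ultrametric[OF p, of "X m - X n" "Y m - Y n"] M N that
    by (simp add: algebra_simps) (smt (verit))
  then show "\<exists>N. \<forall>m\<ge>N. \<forall>n\<ge>N. padic_abs p (X m + Y m - (X n + Y n)) < e"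
    by blast
qed

lemma padic_cauchy_minus: "prime p \<Longrightarrow> padic_cauchy p X \<Longrightarrow> padic_cauchy p (\<lambda>k. - X k)"
  unfolding padic_cauchy_def by (metis minus_diff_minus padic_abs_minus)

lemma padic_cauchy_diff:
  "prime p \<Longrightarrow> padic_cauchy p X \<Longrightarrow> padic_cauchy p Y \<Longrightarrow> padic_cauchy p (\<lambda>k. X k - Y k)"
  using padic_cauchy_add[of p X "\<lambda>k. - Y k"] padic_cauchy_minus[of p Y] by simp

lemma padic_cauchy_convergent_abs:
  assumes p: "prime p" and X: "padic_cauchy p X"
  shows "convergent (\<lambda>k. padic_abs p (X k))"
proof -
  have "Cauchy (\<lambda>k. padic_abs p (X k))"
    unfolding Cauchy_def dist_real_def
    using X padic_abs_triangle_diff[OF p] unfolding padic_cauchy_def by (meson le_less_trans)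
  then show ?thesis
    by (simp add: Cauchy_convergent_iff)
qed

typedef ('p::prime_card) padic_seq = "{S. padic_cauchy (CARD('p)) S}"
  by (auto intro: padic_cauchy_const)

setup_lifting type_definition_padic_seq

instantiation padic_seq :: (prime_card) ab_group_add
begin

lift_definition zero_padic_seq :: "'a padic_seq" is "\<lambda>_. 0"
  by (rule padic_cauchy_const)

lift_definition plus_padic_seq :: "'a padic_seq \<Rightarrow> 'a padic_seq \<Rightarrow> 'a padic_seq"
  is "\<lambda>S R k. S k + R k"
  by (rule padic_cauchy_add[OF prime_card])

lift_definition uminus_padic_seq :: "'a padic_seq \<Rightarrow> 'a padic_seq" is "\<lambda>S k. - S k"
  by (rule padic_cauchy_minus[OF prime_card])

lift_definition minus_padic_seq :: "'a padic_seq \<Rightarrow> 'a padic_seq \<Rightarrow> 'a padic_seq"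
  is "\<lambda>S R k. S k - R k"
  by (rule padic_cauchy_diff[OF prime_card])

instance
  by standard (transfer; simp add: algebra_simps)+

end

lift_definition padic_seq_abs :: "'p::prime_card padic_seq \<Rightarrow> real"
  is "\<lambda>S. lim (\<lambda>k. padic_abs (CARD('p)) (S k))" .

lemma padic_seq_abs_LIMSEQ:
  "(\<lambda>k. padic_abs (CARD('p)) (Rep_padic_seq (s :: 'p::prime_card padic_seq) k)) \<longlonglongrightarrow> padic_seq_abs s"
  using Rep_padic_seq[of s] padic_cauchy_convergent_abs[OF prime_card, of "Rep_padic_seq s"]
  by (simp add: padic_seq_abs.rep_eq convergent_LIMSEQ_iff)

lemma padic_seq_abs_0 [simp]: "padic_seq_abs 0 = 0"
  by transfer simp

lemma padic_seq_abs_nonneg: "padic_seq_abs s \<ge> 0"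
  by (rule LIMSEQ_le_const[OF padic_seq_abs_LIMSEQ]) simp

lemma padic_seq_abs_minus [simp]: "padic_seq_abs (- s) = padic_seq_abs s"
  by transfer (simp add: prime_card)

lemma padic_seq_abs_minus_commute: "padic_seq_abs (s - r) = padic_seq_abs (r - s)"
  using padic_seq_abs_minus[of "s - r"] by simp

lemma padic_seq_abs_triangle: "padic_seq_abs (s + r) \<le> padic_seq_abs s + padic_seq_abs r"
  by (intro LIMSEQ_le[OF padic_seq_abs_LIMSEQ
        tendsto_add[OF padic_seq_abs_LIMSEQ[of s] padic_seq_abs_LIMSEQ[of r]]])
     (auto simp: plus_padic_seq.rep_eq intro: padic_abs_triangle[OF prime_card])

text \<open>Two Cauchy sequences are equivalent if their difference is a null sequence.\<close>

definition padic_seq_eq :: "'p::prime_card padic_seq \<Rightarrow> 'p padic_seq \<Rightarrow> bool" where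
  "padic_seq_eq s r \<longleftrightarrow> padic_seq_abs (s - r) = 0"

lemma padic_seq_eq_refl [simp]: "padic_seq_eq s s"
  by (simp add: padic_seq_eq_def)

lemma padic_seq_eq_abs:
  assumes "padic_seq_eq s r"
  shows "padic_seq_abs s = padic_seq_abs r"
  using assms padic_seq_abs_triangle[of "s - r" r] padic_seq_abs_triangle[of "r - s" s]
  by (simp add: padic_seq_eq_def padic_seq_abs_minus_commute)

lemma padic_seq_eq_add:
  assumes "padic_seq_eq s s'" "padic_seq_eq r r'"
  shows "padic_seq_eq (s + r) (s' + r')"
  using assms padic_seq_abs_triangle[of "s - s'" "r - r'"] padic_seq_abs_nonneg[of "s + r - (s' + r')"]
  by (simp add: padic_seq_eq_def algebra_simps)

lemma padic_seq_eq_minus: "padic_seq_eq s s' \<Longrightarrow> padic_seq_eq (- s) (- s')"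
  using padic_seq_abs_minus_commute[of s s'] by (simp add: padic_seq_eq_def)

lemma padic_seq_eq_diff:
  "padic_seq_eq s s' \<Longrightarrow> padic_seq_eq r r' \<Longrightarrow> padic_seq_eq (s - r) (s' - r')"
  using padic_seq_eq_add[OF _ padic_seq_eq_minus, of s s' r r'] by simp

lemma equivp_padic_seq_eq: "equivp (padic_seq_eq :: 'p::prime_card padic_seq \<Rightarrow> _)"
proof (rule equivpI)
  show "transp (padic_seq_eq :: 'p padic_seq \<Rightarrow> _)"
  proof (rule transpI)
    fix s r t :: "'p padic_seq"
    assume "padic_seq_eq s r" "padic_seq_eq r t"
    then show "padic_seq_eq s t"
      using padic_seq_abs_triangle[of "s - r" "r - t"] padic_seq_abs_nonneg[of "s - t"]
      by (simp add: padic_seq_eq_def)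
  qed
qed (auto simp: reflp_def symp_def padic_seq_eq_def padic_seq_abs_minus_commute)

quotient_type (overloaded) 'p padic = "'p::prime_card padic_seq" / padic_seq_eq
  by (rule equivp_padic_seq_eq)

instantiation padic :: (prime_card) ab_group_add
begin

lift_definition zero_padic :: "'a padic" is 0 .

lift_definition plus_padic :: "'a padic \<Rightarrow> 'a padic \<Rightarrow> 'a padic" is "(+)"
  by (rule padic_seq_eq_add)

lift_definition uminus_padic :: "'a padic \<Rightarrow> 'a padic" is uminus
  by (rule padic_seq_eq_minus)

lift_definition minus_padic :: "'a padic \<Rightarrow> 'a padic \<Rightarrow> 'a padic" is "(-)"
  by (rule padic_seq_eq_diff)

instance
  by standard (transfer; simp add: algebra_simps)+

end

instantiation padic :: (prime_card) metric_space
begin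

lift_definition dist_padic :: "'a padic \<Rightarrow> 'a padic \<Rightarrow> real" is "\<lambda>s r. padic_seq_abs (s - r)"
  by (intro padic_seq_eq_abs padic_seq_eq_diff)

definition uniformity_padic :: "('a padic \<times> 'a padic) filter" where
  "uniformity_padic = (INF e\<in>{0<..}. principal {(x, y). dist x y < e})"

definition open_padic :: "'a padic set \<Rightarrow> bool" where
  "open_padic U \<longleftrightarrow> (\<forall>x\<in>U. \<forall>\<^sub>F (x', y) in uniformity. x' = x \<longrightarrow> y \<in> U)"

instance
proof
  fix x y z :: "'a padic"
  show "dist x y = 0 \<longleftrightarrow> x = y"
    by transfer (simp add: padic_seq_eq_def)
  show "dist x y \<le> dist x z + dist y z"
  proof transfer
    fix s r t :: "'a padic_seq"
    show "padic_seq_abs (s - r) \<le> padic_seq_abs (s - t) + padic_seq_abs (r - t)"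
      using padic_seq_abs_triangle[of "s - t" "t - r"] padic_seq_abs_minus_commute[of t r] by simp
  qed
qed (simp_all only: uniformity_padic_def open_padic_def)

end

definition padic_group :: "'p::prime_card padic monoid" where
  "padic_group = \<lparr>carrier = UNIV, monoid.mult = (+), one = 0\<rparr>"

definition padic_power_group :: "nat \<Rightarrow> (nat \<Rightarrow> 'p::prime_card padic) monoid" where
  "padic_power_group n = product_group {..<n} (\<lambda>_. padic_group)"

definition padic_power_topology :: "nat \<Rightarrow> (nat \<Rightarrow> 'p::prime_card padic) topology" where
  "padic_power_topology n = product_topology (\<lambda>_. euclidean) {..<n}"


section \<open>Haar measures and topological entropy\<close>

text \<open>
  In this section a topological group is a pair of a group \<open>G\<close> and a topology \<open>T\<close> with
  \<^prop>\<open>topspace T = carrier G\<close>.  The Haar measure used for the entropy is an explicit argument \<open>M\<close>;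
  rescaling \<open>M\<close> by a positive constant does not change the entropy.
\<close>

text \<open>A nonzero left invariant Radon measure on the Borel sets of \<open>T\<close>.\<close>

definition left_haar_measure ::
    "('a, 'b) monoid_scheme \<Rightarrow> 'a topology \<Rightarrow> 'a measure \<Rightarrow> bool" where
  "left_haar_measure G T M \<longleftrightarrow>
     space M = topspace T \<and>
     sets M = sigma_sets (topspace T) {U. openin T U} \<and>
     emeasure M (space M) \<noteq> 0 \<and>
     (\<forall>K\<in>sets M. compactin T K \<longrightarrow> emeasure M K < \<infinity>) \<and>
     (\<forall>A\<in>sets M. emeasure M A = (INF U\<in>{U. openin T U \<and> A \<subseteq> U}. emeasure M U)) \<and>
     (\<forall>U. openin T U \<longrightarrow>
        emeasure M U = (SUP K\<in>{K \<in> sets M. compactin T K \<and> K \<subseteq> U}. emeasure M K)) \<and>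
     (\<forall>g\<in>carrier G. \<forall>A\<in>sets M. emeasure M (g <#\<^bsub>G\<^esub> A) = emeasure M A)"

definition compact_id_nbhds :: "('a, 'b) monoid_scheme \<Rightarrow> 'a topology \<Rightarrow> 'a set set" where
  "compact_id_nbhds G T = {U. compactin T U \<and> (\<exists>V. openin T V \<and> \<one>\<^bsub>G\<^esub> \<in> V \<and> V \<subseteq> U)}"

definition cotrajectory :: "'a topology \<Rightarrow> ('a \<Rightarrow> 'a) \<Rightarrow> 'a set \<Rightarrow> nat \<Rightarrow> 'a set" where
  "cotrajectory T \<phi> U n = {x \<in> topspace T. \<forall>k<n. (\<phi> ^^ k) x \<in> U}"

text \<open>
  For a continuous endomorphism \<open>\<phi>\<close> of a locally compact group and a compact neighbourhood \<open>U\<close> of the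
  identity, the cotrajectory is itself a compact neighbourhood of the identity for \<open>n \<ge> 1\<close>, so its
  measure is positive and finite and the real logarithm below is the true one.
\<close>

definition top_entropy_at ::
    "'a topology \<Rightarrow> 'a measure \<Rightarrow> ('a \<Rightarrow> 'a) \<Rightarrow> 'a set \<Rightarrow> ereal" where
  "top_entropy_at T M \<phi> U =
     limsup (\<lambda>n. ereal (- ln (measure M (cotrajectory T \<phi> U n)) / real n))"

definition top_entropy ::
    "('a, 'b) monoid_scheme \<Rightarrow> 'a topology \<Rightarrow> 'a measure \<Rightarrow> ('a \<Rightarrow> 'a) \<Rightarrow> ereal" where
  "top_entropy G T M \<phi> = (SUP U\<in>compact_id_nbhds G T. top_entropy_at T M \<phi> U)"

definition continuous_endo ::
    "('a, 'b) monoid_scheme \<Rightarrow> 'a topology \<Rightarrow> ('a \<Rightarrow> 'a) \<Rightarrow> bool" where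
  "continuous_endo G T \<phi> \<longleftrightarrow> \<phi> \<in> hom G G \<and> continuous_map T T \<phi>"


section \<open>Quotient groups\<close>

definition quotient_topology ::
    "('a, 'b) monoid_scheme \<Rightarrow> 'a topology \<Rightarrow> 'a set \<Rightarrow> 'a set topology" where
  "quotient_topology G T H = topology (\<lambda>\<U>. \<U> \<subseteq> carrier (G Mod H) \<and>
     openin T {x \<in> topspace T. H #>\<^bsub>G\<^esub> x \<in> \<U>})"

lemma openin_quotient_topology:
  "openin (quotient_topology G T H) \<U> \<longleftrightarrow>
     \<U> \<subseteq> carrier (G Mod H) \<and> openin T {x \<in> topspace T. H #>\<^bsub>G\<^esub> x \<in> \<U>}"
proof -
  have "istopology (\<lambda>\<U>. \<U> \<subseteq> carrier (G Mod H) \<and> openin T {x \<in> topspace T. H #>\<^bsub>G\<^esub> x \<in> \<U>})"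
    unfolding istopology_def
  proof (intro conjI allI impI; (elim conjE)?)
    fix S R
    assume "openin T {x \<in> topspace T. H #>\<^bsub>G\<^esub> x \<in> S}" "openin T {x \<in> topspace T. H #>\<^bsub>G\<^esub> x \<in> R}"
    then have "openin T ({x \<in> topspace T. H #>\<^bsub>G\<^esub> x \<in> S} \<inter> {x \<in> topspace T. H #>\<^bsub>G\<^esub> x \<in> R})"
      by (rule openin_Int)
    also have "{x \<in> topspace T. H #>\<^bsub>G\<^esub> x \<in> S} \<inter> {x \<in> topspace T. H #>\<^bsub>G\<^esub> x \<in> R}
        = {x \<in> topspace T. H #>\<^bsub>G\<^esub> x \<in> S \<inter> R}"
      by auto
    finally show "openin T {x \<in> topspace T. H #>\<^bsub>G\<^esub> x \<in> S \<inter> R}" .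
  next
    fix \<K>
    assume K: "\<forall>K\<in>\<K>. K \<subseteq> carrier (G Mod H) \<and> openin T {x \<in> topspace T. H #>\<^bsub>G\<^esub> x \<in> K}"
    have "{x \<in> topspace T. H #>\<^bsub>G\<^esub> x \<in> \<Union>\<K>} = (\<Union>K\<in>\<K>. {x \<in> topspace T. H #>\<^bsub>G\<^esub> x \<in> K})"
      by auto
    then show "openin T {x \<in> topspace T. H #>\<^bsub>G\<^esub> x \<in> \<Union>\<K>}"
      using K by auto
  qed auto
  then show ?thesis
    by (simp add: quotient_topology_def)
qed

lemma quotient_map_quotient_topology:
  assumes "topspace T = carrier G"
  shows "quotient_map T (quotient_topology G T H) (\<lambda>x. H #>\<^bsub>G\<^esub> x)"
proof -
  have "{x \<in> topspace T. H #>\<^bsub>G\<^esub> x \<in> carrier (G Mod H)} = topspace T"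
    using assms by (auto simp: carrier_FactGroup)
  then have "openin (quotient_topology G T H) (carrier (G Mod H))"
    by (simp add: openin_quotient_topology)
  then have "topspace (quotient_topology G T H) = carrier (G Mod H)"
    using openin_quotient_topology[of G T H] openin_topspace openin_subset by blast
  then show ?thesis
    using assms by (auto simp: quotient_map_def openin_quotient_topology carrier_FactGroup)
qed

text \<open>
  The set \<open>H <#> \<phi> ` X\<close> is the coset of \<open>H\<close> that contains the image under \<open>\<phi>\<close> of the coset \<open>X\<close>.
\<close>

definition induced_endo ::
    "('a, 'b) monoid_scheme \<Rightarrow> 'a set \<Rightarrow> ('a \<Rightarrow> 'a) \<Rightarrow> 'a set \<Rightarrow> 'a set" where
  "induced_endo G H \<phi> X = H <#>\<^bsub>G\<^esub> (\<phi> ` X)"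

lemma (in group) induced_endo_r_coset:
  assumes \<phi>: "\<phi> \<in> hom G G" and H: "subgroup H G" and inv: "\<phi> ` H \<subseteq> H" and x: "x \<in> carrier G"
  shows "induced_endo G H \<phi> (H #> x) = H #> \<phi> x"
proof -
  have HG: "H \<subseteq> carrier G"
    using H by (rule subgroup.subset)
  have \<phi>x: "\<phi> y \<in> carrier G" if "y \<in> carrier G" for y
    using \<phi> that by (auto simp: hom_def)
  have eq: "\<phi> ` (H #> x) = (\<phi> ` H) #> \<phi> x"
  proof -
    have "\<phi> (h \<otimes> x) = \<phi> h \<otimes> \<phi> x" if "h \<in> H" for h
      using hom_mult[OF \<phi>, of h x] HG x that by auto
    then show ?thesis
      by (simp add: r_coset_def image_UN)
  qed
  have \<phi>H: "\<phi> ` H \<subseteq> carrier G"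
    using inv HG by auto
  have "H <#> (\<phi> ` H) = H"
  proof
    show "H <#> (\<phi> ` H) \<subseteq> H"
      using inv subgroup.m_closed[OF H] by (auto simp: set_mult_def)
    have one: "\<one> \<in> \<phi> ` H"
      using hom_one[OF \<phi> is_group is_group] subgroup.one_closed[OF H] by (metis imageI)
    show "H \<subseteq> H <#> (\<phi> ` H)"
    proof
      fix h
      assume "h \<in> H"
      moreover from this have "h \<otimes> \<one> = h"
        using HG by auto
      ultimately show "h \<in> H <#> (\<phi> ` H)"
        using one unfolding set_mult_def by (metis UN_iff singletonI)
    qed
  qed
  then show ?thesis
    unfolding induced_endo_def eq using setmult_rcos_assoc[OF HG \<phi>H \<phi>x[OF x]] by simp
qed

end

theory Submission
  imports Defs
begin

text \<open>
  The argument takes place in abelian topological groups in which the compact open subgroups form a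
  base of neighbourhoods of the identity.  The group of vectors over the p-adic numbers is of this
  kind, and so are its closed subgroups and its quotients by them, so that the three entropies of the
  formula can be treated alike.

  For a compact open subgroup \<open>U\<close> with cotrajectories \<open>C\<^sub>n(U)\<close>, invariance of the Haar measure says that
  the measure of \<open>C\<^sub>n(U)\<close> is that of \<open>U\<close> divided by the index \<open>[U : C\<^sub>n(U)]\<close>.  Hence the entropy at \<open>U\<close>
  is the exponential growth rate of this index.  The successive indices \<open>[C\<^sub>n(U) : C\<^sub>n\<^sub>+\<^sub>1(U)]\<close> decrease
  and therefore become constant, so the growth rate is a limit (lemma \<open>growth_rate_LIMSEQ\<close>), and
  the topological entropy is the supremum of the growth rates (lemma \<open>top_entropy_eq_SUP\<close>).

  With \<open>\<pi>\<close> the projection modulo \<open>H\<close>, the index \<open>[U : C\<^sub>n(U)]\<close> is the product of the index of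
  \<open>C\<^sub>n(U) \<inter> H\<close> in \<open>U \<inter> H\<close> and that of \<open>\<pi>(C\<^sub>n(U))\<close> in \<open>\<pi>(U)\<close>.  The first one belongs to the entropy
  of the restriction, because \<open>C\<^sub>n(U) \<inter> H = C\<^sub>n(U \<inter> H)\<close>.  Since \<open>\<pi>(C\<^sub>n(U)) \<subseteq> C\<^sub>n(\<pi>(U))\<close>, the second one
  is at least the index of \<open>C\<^sub>n(\<pi>(U))\<close> in \<open>\<pi>(U)\<close>, which belongs to the entropy of the induced
  map.  So the entropy is at least the sum.

  For the converse it is enough to find, for each compact open subgroup \<open>L\<close>, a smaller one \<open>U\<close> with
  \<open>C\<^sub>n(\<pi>(U)) \<subseteq> \<pi>(C\<^sub>n(L))\<close> for all \<open>n\<close> (lemma \<open>cotrajectory_quotient_subset\<close>).  That is a shadowing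
  statement: if the orbit of \<open>x\<close> stays near \<open>H\<close>, then an element of \<open>H\<close> has an orbit that follows it
  closely.  The components of the orbit of \<open>x\<close> along \<open>H\<close> form an orbit of the restriction
  perturbed by small errors, and the errors can be removed if the recursion
  \<open>w (k + 1) = \<phi>(w k) \<cdot> b k\<close> with small \<open>b\<close> has a small solution \<open>w\<close> (lemma
  \<open>perturbed_orbit_in_subgroup\<close>).  Such a solution exists inside a subgroup each of whose elements is
  a product of an element with a long backward orbit and one with a long forward orbit in it.
  Cotrajectories of any compact open subgroup have this property as soon as the successive indices
  are constant (lemma \<open>exists_factorizing_subgroup\<close>).
\<close>

(* Below, <# denotes left cosets only. *)
no_notation (input) subset_mset (infix "<#" 50)

section \<open>Indices of subgroups\<close>

text \<open>
  The number of left cosets of \<open>B\<close> that meet \<open>A\<close>, which is the index when \<open>B\<close> is a subgroup of \<open>A\<close>.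
  Arbitrary sets \<open>A\<close> are admitted because it is applied to images under homomorphisms.  An infinite
  index is 0, so that finiteness of an index is expressed by its being positive.
\<close>

definition subgroup_index :: "('a, 'b) monoid_scheme \<Rightarrow> 'a set \<Rightarrow> 'a set \<Rightarrow> nat" where
  "subgroup_index G A B = card ((\<lambda>x. x <#\<^bsub>G\<^esub> B) ` A)"

lemma card_image_eq_of_same_fibres:
  assumes "\<And>x y. x \<in> A \<Longrightarrow> y \<in> A \<Longrightarrow> f x = f y \<longleftrightarrow> g x = g y"
  shows "card (f ` A) = card (g ` A)"
proof (rule bij_betw_same_card)
  have *: "g (inv_into A f (f x)) = g x" if "x \<in> A" for x
    using that assms[of "inv_into A f (f x)" x] by (auto intro: inv_into_into f_inv_into_f)
  show "bij_betw (\<lambda>z. g (inv_into A f z)) (f ` A) (g ` A)"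
    unfolding bij_betw_def
  proof
    show "inj_on (\<lambda>z. g (inv_into A f z)) (f ` A)"
    proof (rule inj_onI, elim imageE)
      fix z z' x x'
      assume "g (inv_into A f z) = g (inv_into A f z')" "z = f x" "x \<in> A" "z' = f x'" "x' \<in> A"
      then show "z = z'"
        using *[of x] *[of x'] assms[of x x'] by metis
    qed
    show "(\<lambda>z. g (inv_into A f z)) ` f ` A = g ` A"
      unfolding image_image using * by (rule image_cong[OF refl])
  qed
qed

lemma lcoset_subset_cong: "H <#\<^bsub>G\<lparr>carrier := K\<rparr>\<^esub> A = H <#\<^bsub>G\<^esub> A"
  by (simp add: l_coset_def)

lemma (in group_hom) subgroup_vimage:
  assumes "subgroup B H"
  shows "subgroup {x \<in> carrier G. h x \<in> B} G"
proof (rule G.subgroupI)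
  show "{x \<in> carrier G. h x \<in> B} \<noteq> {}"
    using subgroup.one_closed[OF assms] by (auto intro!: exI[of _ "\<one>"])
qed (auto simp: subgroup.m_closed[OF assms] subgroup.m_inv_closed[OF assms])

context group
begin

lemma lcoset_eq_iff:
  assumes B: "subgroup B G" and x: "x \<in> carrier G" and y: "y \<in> carrier G"
  shows "x <# B = y <# B \<longleftrightarrow> inv x \<otimes> y \<in> B"
proof
  assume "x <# B = y <# B"
  moreover have "y \<in> y <# B"
    using subgroup.one_closed[OF B] y unfolding l_coset_def by force
  ultimately obtain b where b: "b \<in> B" "y = x \<otimes> b"
    unfolding l_coset_def by auto
  then show "inv x \<otimes> y \<in> B"
    using x subgroup.mem_carrier[OF B] by (simp add: m_assoc[symmetric])
next
  assume "inv x \<otimes> y \<in> B"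
  moreover have "y = x \<otimes> (inv x \<otimes> y)"
    using x y by (simp add: m_assoc[symmetric])
  ultimately have "y \<in> x <# B"
    unfolding l_coset_def by blast
  then show "x <# B = y <# B"
    by (rule l_repr_independence[OF _ x B])
qed

lemma mem_lcoset_self: "subgroup B G \<Longrightarrow> x \<in> carrier G \<Longrightarrow> x \<in> x <# B"
  using subgroup.one_closed[of B G] unfolding l_coset_def by force

lemma lcoset_subset: "subgroup A G \<Longrightarrow> B \<subseteq> A \<Longrightarrow> x \<in> A \<Longrightarrow> x <# B \<subseteq> A"
  unfolding l_coset_def by (auto intro: subgroup.m_closed)

text \<open>
  First isomorphism theorem for indices: \<open>f\<close> induces an injection from the cosets of the preimage
  of \<open>B'\<close> in \<open>A\<close> to the cosets of \<open>B'\<close>, and the image consists of the cosets that meet \<open>f ` A\<close>.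
\<close>

lemma subgroup_index_vimage:
  assumes G': "group G'" and f: "f \<in> hom A' G'" and A': "A' = G\<lparr>carrier := A\<rparr>"
    and A: "subgroup A G" and B': "subgroup B' G'"
  shows "subgroup_index G A {x \<in> A. f x \<in> B'} = subgroup_index G' (f ` A) B'"
proof -
  interpret A: group A'
    unfolding A' by (rule subgroup.subgroup_is_group[OF A is_group])
  interpret G': group G'
    by (rule G')
  interpret f: group_hom A' G' f
    using f by unfold_locales
  have cA: "carrier A' = A"
    by (simp add: A')
  have N: "subgroup {x \<in> A. f x \<in> B'} G"
    using incl_subgroup[OF A] f.subgroup_vimage[OF B'] unfolding A' by simp
  have eq: "x <# {x \<in> A. f x \<in> B'} = y <# {x \<in> A. f x \<in> B'} \<longleftrightarrow> f x <#\<^bsub>G'\<^esub> B' = f y <#\<^bsub>G'\<^esub> B'"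
    if xy: "x \<in> A" "y \<in> A" for x y
  proof -
    have inv: "inv\<^bsub>A'\<^esub> x = inv x"
      unfolding A' using m_inv_consistent[OF A] xy by simp
    have "inv x \<otimes> y \<in> A" "f (inv x \<otimes> y) = inv\<^bsub>G'\<^esub> (f x) \<otimes>\<^bsub>G'\<^esub> f y"
      using f.hom_mult[of "inv\<^bsub>A'\<^esub> x" y] f.hom_inv[of x] xy cA A.inv_closed[of x] A inv
      by (auto simp: A' subgroup.m_closed subgroup.m_inv_closed)
    moreover have "f x \<in> carrier G'" "f y \<in> carrier G'"
      using xy cA f.hom_closed by auto
    ultimately show ?thesis
      using xy subgroup.mem_carrier[OF A] by (simp add: lcoset_eq_iff[OF N] G'.lcoset_eq_iff[OF B'])
  qed
  show ?thesis
    unfolding subgroup_index_def image_image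
    by (rule card_image_eq_of_same_fibres) (rule eq)
qed

text \<open>
  Fixing in each coset of \<open>B\<close> in \<open>A\<close> a representative \<open>r x\<close> of \<open>x\<close> identifies the cosets of \<open>C\<close>
  with pairs of a coset of \<open>B\<close> in \<open>A\<close> and a coset of \<open>C\<close> in \<open>B\<close>.
\<close>

lemma subgroup_index_mult:
  assumes A: "subgroup A G" and B: "subgroup B G" and C: "subgroup C G"
    and CB: "C \<subseteq> B" and BA: "B \<subseteq> A"
  shows "subgroup_index G A C = subgroup_index G A B * subgroup_index G B C"
proof -
  define r where "r x = inv_into A (\<lambda>x. x <# B) (x <# B)" for x
  have rA: "r x \<in> A" and r: "r x <# B = x <# B" if "x \<in> A" for x
    unfolding r_def using that inv_into_into[of "x <# B" "\<lambda>x. x <# B" A]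
      f_inv_into_f[of "x <# B" "\<lambda>x. x <# B" A] by simp_all
  have rcong: "r x = r y" if "x <# B = y <# B" for x y
    unfolding r_def using that by simp
  have Ac: "x \<in> carrier G" if "x \<in> A" for x
    using that subgroup.mem_carrier[OF A] by simp
  have rB: "inv (r x) \<otimes> x \<in> B" if "x \<in> A" for x
    using r[OF that] lcoset_eq_iff[OF B, of "r x" x] rA[OF that] that Ac by simp
  define g where "g x = (x <# B, (inv (r x) \<otimes> x) <# C)" for x
  have "card ((\<lambda>x. x <# C) ` A) = card (g ` A)"
  proof (rule card_image_eq_of_same_fibres)
    fix x y
    assume xy: "x \<in> A" "y \<in> A"
    have "r x \<otimes> (inv (r x) \<otimes> y) = y"
      using xy Ac rA by (simp add: m_assoc[symmetric])
    then have eq: "inv (inv (r x) \<otimes> x) \<otimes> (inv (r x) \<otimes> y) = inv x \<otimes> y"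
      using xy Ac rA by (simp add: inv_mult_group m_assoc)
    have *: "(inv (r x) \<otimes> x) <# C = (inv (r x) \<otimes> y) <# C \<longleftrightarrow> x <# C = y <# C"
      using xy Ac rA eq by (simp add: lcoset_eq_iff[OF C])
    show "x <# C = y <# C \<longleftrightarrow> g x = g y"
      using * rcong[of x y] xy Ac CB by (auto simp: g_def lcoset_eq_iff[OF C] lcoset_eq_iff[OF B])
  qed
  also have "g ` A = ((\<lambda>x. x <# B) ` A) \<times> ((\<lambda>x. x <# C) ` B)"
  proof (intro subset_antisym subsetI)
    fix z
    assume "z \<in> g ` A"
    then show "z \<in> ((\<lambda>x. x <# B) ` A) \<times> ((\<lambda>x. x <# C) ` B)"
      using rB by (auto simp: g_def)
  next
    fix z
    assume "z \<in> ((\<lambda>x. x <# B) ` A) \<times> ((\<lambda>x. x <# C) ` B)"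
    then obtain x b where xb: "x \<in> A" "b \<in> B" "z = (x <# B, b <# C)"
      by auto
    have bA: "b \<in> A" and bc: "b \<in> carrier G"
      using xb BA Ac by auto
    have rxb: "r x \<otimes> b \<in> A"
      using A rA[OF xb(1)] bA by (simp add: subgroup.m_closed)
    have "inv (r x) \<otimes> (r x \<otimes> b) = b"
      using rA[OF xb(1)] Ac bc by (simp add: m_assoc[symmetric])
    moreover from this have "r x <# B = (r x \<otimes> b) <# B"
      using lcoset_eq_iff[OF B, of "r x" "r x \<otimes> b"] rA[OF xb(1)] Ac rxb xb(2) by simp
    moreover from this have "r (r x \<otimes> b) = r x"
      using rcong[of "r x \<otimes> b" x] r[OF xb(1)] by simp
    ultimately have "g (r x \<otimes> b) = z"
      using r[OF xb(1)] xb by (simp add: g_def)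
    then show "z \<in> g ` A"
      using rxb by blast
  qed
  finally show ?thesis
    by (simp add: subgroup_index_def card_cartesian_product)
qed

lemma subgroup_index_mono:
  assumes "A \<subseteq> A'" and "A \<noteq> {}" and pos: "subgroup_index G A' B > 0"
  shows "0 < subgroup_index G A B" and "subgroup_index G A B \<le> subgroup_index G A' B"
proof -
  have fin: "finite ((\<lambda>x. x <# B) ` A')"
    using pos unfolding subgroup_index_def card_gt_0_iff by simp
  then show "0 < subgroup_index G A B"
    using assms(2) finite_subset[OF image_mono[OF assms(1)]]
    unfolding subgroup_index_def card_gt_0_iff by simp
  show "subgroup_index G A B \<le> subgroup_index G A' B"
    unfolding subgroup_index_def using fin assms(1) by (intro card_mono) auto
qed

lemma subgroup_index_antimono:
  assumes A: "subgroup A G" and B: "subgroup B G" and C: "subgroup C G"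
    and CB: "C \<subseteq> B" and BA: "B \<subseteq> A" and pos: "subgroup_index G A C > 0"
  shows "0 < subgroup_index G A B" and "subgroup_index G A B \<le> subgroup_index G A C"
  using pos unfolding subgroup_index_mult[OF A B C CB BA] by simp_all

text \<open>
  For finite indices, equality means that \<open>A\<close> and \<open>A'\<close> meet the same cosets, so that every element
  of \<open>A'\<close> factors through an element of \<open>A\<close> and one of \<open>B\<close>.
\<close>

lemma cosets_meet_of_index_eq:
  assumes "A \<subseteq> A'" and pos: "subgroup_index G A' B > 0"
    and eq: "subgroup_index G A B = subgroup_index G A' B" and x: "x \<in> A'"
  obtains a where "a \<in> A" and "a <# B = x <# B"
proof -
  have "finite ((\<lambda>x. x <# B) ` A')"
    using pos unfolding subgroup_index_def card_gt_0_iff by simp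
  moreover have "(\<lambda>x. x <# B) ` A \<subseteq> (\<lambda>x. x <# B) ` A'"
    using assms(1) by auto
  ultimately have "(\<lambda>x. x <# B) ` A = (\<lambda>x. x <# B) ` A'"
    using eq unfolding subgroup_index_def by (intro card_subset_eq) auto
  then have "x <# B \<in> (\<lambda>x. x <# B) ` A"
    using x by blast
  then show thesis
    using that by auto
qed

end

context comm_group
begin

lemma lcoset_eq_rcoset: "subgroup B G \<Longrightarrow> x \<in> carrier G \<Longrightarrow> x <# B = B #> x"
  using normal_iff_subgroup normal.coset_eq by fastforce

text \<open>
  Between \<open>A\<close> and \<open>B\<close> lies the product of \<open>A \<inter> H\<close> and \<open>B\<close>.  By the isomorphism theorems, its index in
  \<open>A\<close> is counted modulo \<open>H\<close>, and the index of \<open>B\<close> in it is counted in \<open>H\<close>.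
\<close>

lemma subgroup_index_split:
  assumes A: "subgroup A G" and B: "subgroup B G" and H: "subgroup H G" and BA: "B \<subseteq> A"
  defines "\<pi> \<equiv> \<lambda>x. H #> x"
  shows "subgroup_index G A B = subgroup_index (G\<lparr>carrier := H\<rparr>) (A \<inter> H) (B \<inter> H)
           * subgroup_index (G Mod H) (\<pi> ` A) (\<pi> ` B)"
proof -
  have nH: "H \<lhd> G"
    using H normal_iff_subgroup by simp
  interpret Q: group "G Mod H"
    by (rule normal.factorgroup_is_group[OF nH])
  have \<pi>: "\<pi> \<in> hom G (G Mod H)"
    unfolding \<pi>_def by (rule normal.r_coset_hom_Mod[OF nH])
  interpret \<pi>: group_hom G "G Mod H" \<pi>
    using \<pi> by unfold_locales
  have \<pi>A: "\<pi> \<in> hom (G\<lparr>carrier := A\<rparr>) (G Mod H)"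
    using \<pi>.hom_mult \<pi>.hom_closed
    by (intro homI) (simp_all add: subgroup.mem_carrier[OF A] del: mult_FactGroup)
  have \<pi>B: "subgroup (\<pi> ` B) (G Mod H)"
    by (rule \<pi>.subgroup_img_is_subgroup[OF B])
  define B1 where "B1 = {x \<in> A. \<pi> x \<in> \<pi> ` B}"
  have "B1 = A \<inter> {x \<in> carrier G. \<pi> x \<in> \<pi> ` B}"
    using subgroup.subset[OF A] by (auto simp: B1_def)
  then have B1: "subgroup B1 G"
    using subgroups_Inter_pair[OF A \<pi>.subgroup_vimage[OF \<pi>B]] by simp
  have AH: "subgroup (A \<inter> H) G"
    using A H by (rule subgroups_Inter_pair)
  have "subgroup_index G A B1 = subgroup_index (G Mod H) (\<pi> ` A) (\<pi> ` B)"
    unfolding B1_def by (rule subgroup_index_vimage[OF Q.is_group \<pi>A refl A \<pi>B])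
  moreover have "subgroup_index G B1 B = subgroup_index (G\<lparr>carrier := H\<rparr>) (A \<inter> H) (B \<inter> H)"
  proof -
    have "(\<lambda>x. x) \<in> hom (G\<lparr>carrier := A \<inter> H\<rparr>) G"
      using subgroup.subset[OF AH] by (auto simp: hom_def)
    moreover have "{x \<in> A \<inter> H. x \<in> B} = B \<inter> H"
      using BA by auto
    ultimately have "subgroup_index G (A \<inter> H) (B \<inter> H) = subgroup_index G (A \<inter> H) B"
      using subgroup_index_vimage[OF is_group _ refl AH B, of "\<lambda>x. x"] by simp
    moreover have "(\<lambda>x. x <# B) ` B1 = (\<lambda>x. x <# B) ` (A \<inter> H)"
    proof (intro subset_antisym image_subsetI)
      fix x
      assume x: "x \<in> B1"
      then obtain b where b: "b \<in> B" and eq: "\<pi> x = \<pi> b" and xA: "x \<in> A"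
        unfolding B1_def by auto
      have c: "x \<in> carrier G" "b \<in> carrier G"
        using xA b subgroup.mem_carrier[OF A] subgroup.mem_carrier[OF B] by auto
      have "inv b \<otimes> x \<in> H"
        using eq[symmetric] c H unfolding \<pi>_def by (simp flip: lcoset_eq_rcoset add: lcoset_eq_iff)
      then have "inv b \<otimes> x \<in> A \<inter> H"
        using A xA b BA by (auto simp: subgroup.m_closed subgroup.m_inv_closed)
      moreover have "(inv b \<otimes> x) <# B = x <# B"
        using c b B by (simp add: lcoset_eq_iff inv_mult_group m_ac)
      ultimately show "x <# B \<in> (\<lambda>x. x <# B) ` (A \<inter> H)"
        by (metis imageI)
    next
      fix x
      assume x: "x \<in> A \<inter> H"
      then have "\<pi> x = \<one>\<^bsub>G Mod H\<^esub>"
        unfolding \<pi>_def using coset_join2[OF _ H, of x] subgroup.mem_carrier[OF H] by simp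
      then have "\<pi> x \<in> \<pi> ` B"
        using subgroup.one_closed[OF \<pi>B] by (simp only:)
      then have "x \<in> B1"
        using x by (simp add: B1_def)
      then show "x <# B \<in> (\<lambda>x. x <# B) ` B1"
        by blast
    qed
    ultimately show ?thesis
      unfolding subgroup_index_def by (simp add: lcoset_subset_cong)
  qed
  moreover have "B \<subseteq> B1" "B1 \<subseteq> A"
    using BA by (auto simp: B1_def)
  ultimately show ?thesis
    using subgroup_index_mult[OF A B1 B] by (simp add: mult.commute)
qed

end

section \<open>Abelian groups topologized by open subgroups\<close>

text \<open>
  The last two conditions together say that the left cosets of open subgroups form a base of the topology.
  Splitting them makes each easy to check for closed subgroups and for quotients; continuity of the
  group operations follows.
\<close>

locale nonarchimedean_group = comm_group G for G (structure) +
  fixes T :: "'a topology"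
  assumes topspace_eq: "topspace T = carrier G"
    and open_subgroup_base:
      "openin T W \<Longrightarrow> x \<in> W \<Longrightarrow> \<exists>B. subgroup B G \<and> openin T B \<and> x <# B \<subseteq> W"
    and openin_lcoset: "subgroup B G \<Longrightarrow> openin T B \<Longrightarrow> x \<in> carrier G \<Longrightarrow> openin T (x <# B)"
begin

lemma openinI:
  assumes "W \<subseteq> carrier G"
    and "\<And>x. x \<in> W \<Longrightarrow> \<exists>B. subgroup B G \<and> openin T B \<and> x <# B \<subseteq> W"
  shows "openin T W"
  unfolding openin_subopen[of T W] using assms openin_lcoset mem_lcoset_self by (meson subsetD)

lemma openin_saturated:
  assumes "subgroup B G" "openin T B" "W \<subseteq> carrier G" "\<And>x b. x \<in> W \<Longrightarrow> b \<in> B \<Longrightarrow> x \<otimes> b \<in> W"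
  shows "openin T W"
  using assms by (intro openinI) (auto simp: l_coset_def)

lemma closedin_open_subgroup:
  assumes B: "subgroup B G" "openin T B"
  shows "closedin T B"
  unfolding closedin_def
proof
  show "B \<subseteq> topspace T"
    using subgroup.subset[OF B(1)] topspace_eq by simp
  show "openin T (topspace T - B)"
    unfolding topspace_eq
  proof (rule openin_saturated[OF B])
    fix x b
    assume x: "x \<in> carrier G - B" and b: "b \<in> B"
    then have "x \<otimes> b \<otimes> inv b = x" and c: "b \<in> carrier G"
      using subgroup.mem_carrier[OF B(1)] by (auto simp: m_assoc)
    then have "x \<otimes> b \<notin> B"
      using x b subgroup.m_closed[OF B(1), of "x \<otimes> b" "inv b"] subgroup.m_inv_closed[OF B(1)] by auto
    then show "x \<otimes> b \<in> carrier G - B"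
      using x c by simp
  qed auto
qed

text \<open>
  The cosets of an open subgroup are disjoint open sets, so a compact set meets only finitely many.
\<close>

lemma compactin_finite_lcosets:
  assumes A: "compactin T A" and B: "subgroup B G" "openin T B"
  shows "finite ((\<lambda>x. x <# B) ` A)"
proof -
  let ?f = "\<lambda>x. x <# B"
  have Ac: "A \<subseteq> carrier G"
    using A compactin_subset_topspace topspace_eq by blast
  have "\<forall>X\<in>?f ` A. openin T X" "A \<subseteq> \<Union> (?f ` A)"
    using Ac openin_lcoset[OF B] mem_lcoset_self[OF B(1)] by auto
  then obtain F where F: "finite F" "F \<subseteq> ?f ` A" "A \<subseteq> \<Union>F"
    using A[unfolded compactin_def, THEN conjunct2, rule_format, of "?f ` A"] by auto
  have "?f ` A \<subseteq> F"
  proof (rule image_subsetI)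
    fix x
    assume x: "x \<in> A"
    then obtain X where X: "X \<in> F" "x \<in> X"
      using F(3) by (meson UnionE subsetD)
    have "X \<in> ?f ` A"
      using F(2) X(1) by (rule subsetD)
    then obtain a where a: "a \<in> A" "X = ?f a"
      by (rule imageE) simp
    have "?f a = ?f x"
      using l_repr_independence[OF _ _ B(1), of x a] Ac a X by auto
    then show "?f x \<in> F"
      using a X by simp
  qed
  then show ?thesis
    using F(1) by (rule finite_subset)
qed

lemma subgroup_index_pos:
  assumes "compactin T A" "subgroup A G" "subgroup B G" "openin T B"
  shows "subgroup_index G A B > 0"
  using compactin_finite_lcosets[of A B] assms subgroup.one_closed[of A G]
  unfolding subgroup_index_def card_gt_0_iff by auto

end

text \<open>
  These are the neighbourhoods on which the entropy becomes a matter of counting cosets.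
\<close>

definition compact_open_subgroups :: "('a, 'b) monoid_scheme \<Rightarrow> 'a topology \<Rightarrow> 'a set set" where
  "compact_open_subgroups G T = {U. subgroup U G \<and> openin T U \<and> compactin T U}"

lemma compact_open_subgroups_subset_nbhds:
  "compact_open_subgroups G T \<subseteq> compact_id_nbhds G T"
  by (auto simp: compact_open_subgroups_def compact_id_nbhds_def intro: subgroup.one_closed)

locale tdlc_abelian_group = nonarchimedean_group +
  assumes compact_open_subgroups_nonempty: "compact_open_subgroups G T \<noteq> {}"
begin

lemma compact_open_subgroupsI:
  assumes "subgroup V G" "openin T V" "V \<subseteq> U" "compactin T U"
  shows "V \<in> compact_open_subgroups G T"
  using assms closed_compactin[OF _ _ closedin_open_subgroup] by (auto simp: compact_open_subgroups_def)

lemma compact_open_subgroup_base: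
  assumes "openin T W" "\<one> \<in> W"
  obtains U where "U \<in> compact_open_subgroups G T" "U \<subseteq> W"
proof -
  obtain K where K: "subgroup K G" "openin T K" "compactin T K"
    using compact_open_subgroups_nonempty by (auto simp: compact_open_subgroups_def)
  obtain B where B: "subgroup B G" "openin T B" "\<one> <# B \<subseteq> W"
    using open_subgroup_base[OF assms] by blast
  have "B \<inter> K \<in> compact_open_subgroups G T"
    using K B by (intro compact_open_subgroupsI[where U = K])
      (auto intro: subgroups_Inter_pair)
  then show thesis
    using that B lcos_mult_one[OF subgroup.subset[OF B(1)]] by blast
qed

end

section \<open>Haar measures and indices\<close>

lemma left_haar_measureD:
  assumes "left_haar_measure G T M"
  shows "sets M = sigma_sets (topspace T) {U. openin T U}"
    and "emeasure M (topspace T) \<noteq> 0"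
    and "\<And>K. K \<in> sets M \<Longrightarrow> compactin T K \<Longrightarrow> emeasure M K < \<infinity>"
    and "\<And>A. A \<in> sets M \<Longrightarrow> emeasure M A = (INF U\<in>{U. openin T U \<and> A \<subseteq> U}. emeasure M U)"
    and "\<And>U. openin T U \<Longrightarrow>
      emeasure M U = (SUP K\<in>{K \<in> sets M. compactin T K \<and> K \<subseteq> U}. emeasure M K)"
    and "\<And>g A. g \<in> carrier G \<Longrightarrow> A \<in> sets M \<Longrightarrow> emeasure M (g <#\<^bsub>G\<^esub> A) = emeasure M A"
proof -
  note 1 = assms[unfolded left_haar_measure_def]
  note 2 = 1[THEN conjunct2]
  note 3 = 2[THEN conjunct2]
  note 4 = 3[THEN conjunct2]
  note 5 = 4[THEN conjunct2]
  note 6 = 5[THEN conjunct2]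
  show "sets M = sigma_sets (topspace T) {U. openin T U}"
    by (rule 2[THEN conjunct1])
  show "emeasure M (topspace T) \<noteq> 0"
    using 3[THEN conjunct1] unfolding 1[THEN conjunct1] .
  show "emeasure M K < \<infinity>" if "K \<in> sets M" "compactin T K" for K
    using 4[THEN conjunct1, rule_format, OF that] .
  show "emeasure M A = (INF U\<in>{U. openin T U \<and> A \<subseteq> U}. emeasure M U)" if "A \<in> sets M" for A
    using 5[THEN conjunct1, rule_format, OF that] .
  show "emeasure M U = (SUP K\<in>{K \<in> sets M. compactin T K \<and> K \<subseteq> U}. emeasure M K)" if "openin T U" for U
    using 6[THEN conjunct1, rule_format, OF that] .
  show "emeasure M (g <#\<^bsub>G\<^esub> A) = emeasure M A" if "g \<in> carrier G" "A \<in> sets M" for g A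
    using 6[THEN conjunct2, rule_format, OF that] .
qed

context nonarchimedean_group
begin

lemma haar_sets:
  assumes M: "left_haar_measure G T M" and "openin T W"
  shows "W \<in> sets M"
  unfolding left_haar_measureD(1)[OF M] using assms by (simp add: sigma_sets.Basic)

lemma haar_lcoset:
  assumes "left_haar_measure G T M" and "openin T W" and "x \<in> carrier G"
  shows "emeasure M (x <# W) = emeasure M W"
  using left_haar_measureD(6)[OF assms(1) assms(3)] haar_sets[OF assms(1,2)] by simp

lemma haar_compact_finite:
  assumes "left_haar_measure G T M" and "openin T W" and "compactin T W"
  shows "emeasure M W < \<infinity>"
  using left_haar_measureD(3)[OF assms(1) haar_sets[OF assms(1,2)] assms(3)] .

lemma haar_positive_compact:
  assumes M: "left_haar_measure G T M"
  obtains K where "K \<in> sets M" "compactin T K" "emeasure M K > 0"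
proof -
  have "emeasure M (topspace T) \<noteq> 0"
    using left_haar_measureD(2)[OF M] .
  then have "\<not> (SUP K\<in>{K \<in> sets M. compactin T K \<and> K \<subseteq> topspace T}. emeasure M K) \<le> 0"
    unfolding left_haar_measureD(5)[OF M openin_topspace, symmetric] by simp
  then obtain K where "K \<in> {K \<in> sets M. compactin T K \<and> K \<subseteq> topspace T}" "\<not> emeasure M K \<le> 0"
    using SUP_least[of "{K \<in> sets M. compactin T K \<and> K \<subseteq> topspace T}" "emeasure M" 0] by blast
  then show thesis
    by (intro that[of K]) (simp_all add: zero_less_iff_neq_zero)
qed

text \<open>
  Finitely many translates of \<open>B\<close> cover a compact set of positive measure.
\<close>

lemma haar_open_subgroup_pos:
  assumes M: "left_haar_measure G T M" and B: "subgroup B G" "openin T B"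
  shows "emeasure M B > 0"
proof (rule ccontr)
  assume "\<not> emeasure M B > 0"
  then have B0: "emeasure M B = 0"
    by simp
  obtain K where K: "K \<in> sets M" "compactin T K" "emeasure M K > 0"
    by (rule haar_positive_compact[OF M])
  have Kc: "K \<subseteq> carrier G"
    using K compactin_subset_topspace topspace_eq by blast
  let ?F = "(\<lambda>x. x <# B) ` K"
  have F: "X \<in> sets M \<and> emeasure M X = 0" if "X \<in> ?F" for X
    using that Kc haar_sets[OF M openin_lcoset[OF B]] haar_lcoset[OF M B(2)] B0 by auto
  have "emeasure M K \<le> emeasure M (\<Union>X\<in>?F. X)"
  proof (rule emeasure_mono)
    show "K \<subseteq> (\<Union>X\<in>?F. X)"
      using Kc mem_lcoset_self[OF B(1)] by auto
    show "(\<Union>X\<in>?F. X) \<in> sets M"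
      using F compactin_finite_lcosets[OF K(2) B] by (intro sets.finite_UN) simp_all
  qed
  also have "\<dots> \<le> (\<Sum>X\<in>?F. emeasure M X)"
    using F compactin_finite_lcosets[OF K(2) B] by (intro emeasure_subadditive_finite) auto
  also have "\<dots> = 0"
    using F by (simp add: sum.neutral)
  finally show False
    using K by simp
qed

lemma haar_subgroup_index:
  assumes M: "left_haar_measure G T M" and A: "A \<in> compact_open_subgroups G T"
    and B: "subgroup B G" "openin T B" and BA: "B \<subseteq> A"
  shows "measure M A = real (subgroup_index G A B) * measure M B"
proof -
  have A': "subgroup A G" "openin T A" "compactin T A"
    using A by (auto simp: compact_open_subgroups_def)
  have Ac: "x \<in> carrier G" if "x \<in> A" for x
    using that subgroup.mem_carrier[OF A'(1)] by simp
  let ?F = "(\<lambda>x. x <# B) ` A"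
  have fin: "finite ?F"
    using A' B compactin_finite_lcosets by simp
  have F: "X \<in> sets M" "emeasure M X = emeasure M B" if "X \<in> ?F" for X
    using that Ac haar_sets[OF M openin_lcoset[OF B]] haar_lcoset[OF M B(2)] by auto
  have "disjoint_family_on (\<lambda>X. X) ?F"
    unfolding disjoint_family_on_def
  proof (intro ballI impI)
    fix X Y
    assume XY: "X \<in> ?F" "Y \<in> ?F" "X \<noteq> Y"
    then obtain x y where xy: "x \<in> A" "X = x <# B" "y \<in> A" "Y = y <# B"
      by auto
    show "X \<inter> Y = {}"
    proof (rule ccontr)
      assume "X \<inter> Y \<noteq> {}"
      then obtain z where "z \<in> x <# B" "z \<in> y <# B"
        using xy by auto
      then have "x <# B = z <# B" "y <# B = z <# B"
        using l_repr_independence[OF _ _ B(1), of z x] l_repr_independence[OF _ _ B(1), of z y]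
          Ac xy(1,3) by simp_all
      then show False
        using XY xy by simp
    qed
  qed
  moreover have "(\<Union>X\<in>?F. X) = A"
    using lcoset_subset[OF A'(1) BA] mem_lcoset_self[OF B(1)] Ac by auto
  ultimately have "emeasure M A = (\<Sum>X\<in>?F. emeasure M X)"
    using sum_emeasure[of "\<lambda>X. X" ?F M] F(1) fin by (simp add: image_subset_iff)
  also have "\<dots> = (\<Sum>X\<in>?F. emeasure M B)"
    using F by (intro sum.cong) auto
  also have "\<dots> = of_nat (subgroup_index G A B) * emeasure M B"
    by (simp add: subgroup_index_def)
  finally show ?thesis
    unfolding measure_def by (simp add: enn2real_mult)
qed

lemma continuous_map_division: "continuous_map (prod_topology T T) T (\<lambda>(x, y). x \<otimes> inv y)"
  unfolding continuous_map_def
proof (intro conjI allI impI)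
  show "(\<lambda>(x, y). x \<otimes> inv y) \<in> topspace (prod_topology T T) \<rightarrow> topspace T"
    by (auto simp: topspace_eq)
  fix W
  assume W: "openin T W"
  show "openin (prod_topology T T) {z \<in> topspace (prod_topology T T). (case z of (x, y) \<Rightarrow> x \<otimes> inv y) \<in> W}"
    unfolding openin_prod_topology_alt
  proof (intro allI impI)
    fix x y
    assume "(x, y) \<in> {z \<in> topspace (prod_topology T T). (case z of (x, y) \<Rightarrow> x \<otimes> inv y) \<in> W}"
    then have xy: "x \<in> carrier G" "y \<in> carrier G" "x \<otimes> inv y \<in> W"
      by (auto simp: topspace_eq)
    obtain B where B: "subgroup B G" "openin T B" "(x \<otimes> inv y) <# B \<subseteq> W"
      using open_subgroup_base[OF W xy(3)] by blast
    have "(x \<otimes> b) \<otimes> inv (y \<otimes> c) \<in> W" if bc: "b \<in> B" "c \<in> B" for b c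
    proof -
      have "b \<otimes> inv c \<in> B" "b \<in> carrier G" "c \<in> carrier G"
        using bc B(1) subgroup.mem_carrier[OF B(1)] by (auto simp: subgroup.m_closed subgroup.m_inv_closed)
      moreover from this have "(x \<otimes> b) \<otimes> inv (y \<otimes> c) = (x \<otimes> inv y) \<otimes> (b \<otimes> inv c)"
        using xy by (simp add: inv_mult_group m_ac)
      ultimately show ?thesis
        using B(3) by (auto simp: l_coset_def)
    qed
    then have "(x <# B) \<times> (y <# B) \<subseteq>
        {z \<in> topspace (prod_topology T T). (case z of (x, y) \<Rightarrow> x \<otimes> inv y) \<in> W}"
      using xy subgroup.mem_carrier[OF B(1)] by (auto simp: l_coset_def topspace_eq)
    then show "\<exists>U V. openin T U \<and> openin T V \<and> x \<in> U \<and> y \<in> V \<and> U \<times> V \<subseteq>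
        {z \<in> topspace (prod_topology T T). (case z of (x, y) \<Rightarrow> x \<otimes> inv y) \<in> W}"
      using openin_lcoset[OF B(1,2)] mem_lcoset_self[OF B(1)] xy
      by (intro exI[of _ "x <# B"] exI[of _ "y <# B"]) simp
  qed
qed

text \<open>
  Outer regularity gives an open set of finite measure around a compact set, and this open set
  contains a translate of an open subgroup.
\<close>

lemma haar_finite_open_subgroup:
  assumes M: "left_haar_measure G T M"
  obtains B where "subgroup B G" "openin T B" "emeasure M B < \<infinity>"
proof -
  obtain K where K: "K \<in> sets M" "compactin T K" "emeasure M K > 0"
    by (rule haar_positive_compact[OF M])
  have "(INF U\<in>{U. openin T U \<and> K \<subseteq> U}. emeasure M U) < \<infinity>"
    using left_haar_measureD(3)[OF M K(1,2)] unfolding left_haar_measureD(4)[OF M K(1)] .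
  then obtain U where U: "openin T U" "K \<subseteq> U" "emeasure M U < \<infinity>"
    unfolding INF_less_iff by blast
  have "K \<noteq> {}"
    using K(3) by auto
  then obtain x where x: "x \<in> K"
    by blast
  have xG: "x \<in> carrier G"
    using x U(1,2) openin_subset topspace_eq by blast
  obtain B where B: "subgroup B G" "openin T B" "x <# B \<subseteq> U"
    using open_subgroup_base[OF U(1)] x U(2) by blast
  have "emeasure M B = emeasure M (x <# B)"
    using haar_lcoset[OF M B(2) xG] by simp
  also have "\<dots> \<le> emeasure M U"
    by (rule emeasure_mono[OF B(3) haar_sets[OF M U(1)]])
  finally show thesis
    using U(3) by (intro that[OF B(1,2)]) simp
qed

text \<open>
  Local compactness is a consequence of the existence of a Haar measure.  In an open subgroup \<open>B\<close>
  of finite measure, inner regularity provides a compact set \<open>K\<close> of more than half the measure of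
  \<open>B\<close>.  Then \<open>K\<close> meets each of its translates by elements of \<open>B\<close>, so \<open>B\<close> is the set of quotients
  of elements of \<open>K\<close>, a continuous image of a compact set.
\<close>

lemma haar_imp_compact_open_subgroups_nonempty:
  assumes M: "left_haar_measure G T M"
  shows "compact_open_subgroups G T \<noteq> {}"
proof -
  obtain B where B: "subgroup B G" "openin T B" and fin: "emeasure M B < \<infinity>"
    by (rule haar_finite_open_subgroup[OF M])
  define r where "r = measure M B"
  have r: "emeasure M B = ennreal r" "r > 0"
    using fin haar_open_subgroup_pos[OF M B]
    by (simp_all add: r_def measure_def enn2real_positive_iff)
  have "ennreal (r / 2) < emeasure M B"
    using r by (simp add: ennreal_less_iff)
  then have "\<exists>K\<in>{K \<in> sets M. compactin T K \<and> K \<subseteq> B}. ennreal (r / 2) < emeasure M K"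
    unfolding left_haar_measureD(5)[OF M B(2)] less_SUP_iff .
  then obtain K where K: "K \<in> sets M" "compactin T K" "K \<subseteq> B" "ennreal (r / 2) < emeasure M K"
    by blast
  have Bc: "b \<in> carrier G" if "b \<in> B" for b
    using subgroup.mem_carrier[OF B(1) that] .
  have "B = (\<lambda>(x, y). x \<otimes> inv y) ` (K \<times> K)"
  proof
    show "(\<lambda>(x, y). x \<otimes> inv y) ` (K \<times> K) \<subseteq> B"
      using K(3) by (auto intro!: subgroup.m_closed[OF B(1)] subgroup.m_inv_closed[OF B(1)])
    show "B \<subseteq> (\<lambda>(x, y). x \<otimes> inv y) ` (K \<times> K)"
    proof
      fix b
      assume b: "b \<in> B"
      have eq: "emeasure M (b <# K) = emeasure M K"
        by (rule left_haar_measureD(6)[OF M Bc[OF b] K(1)])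
      \<comment> \<open>Non-measurable sets have measure 0, so invariance makes the translate measurable.\<close>
      have "emeasure M (b <# K) \<noteq> 0"
        using K(4) unfolding eq by auto
      then have bK: "b <# K \<in> sets M"
        using emeasure_notin_sets by blast
      have "K \<inter> (b <# K) \<noteq> {}"
      proof
        assume "K \<inter> (b <# K) = {}"
        then have "emeasure M K + emeasure M (b <# K) = emeasure M (K \<union> (b <# K))"
          by (rule plus_emeasure[OF K(1) bK])
        also have "\<dots> \<le> emeasure M B"
          using K(3) lcoset_subset[OF B(1) K(3) b] haar_sets[OF M B(2)] by (intro emeasure_mono) auto
        also have "\<dots> = ennreal (r / 2) + ennreal (r / 2)"
          using r by (simp flip: ennreal_plus)
        also have "\<dots> < emeasure M K + emeasure M (b <# K)"
          unfolding eq by (rule add_strict_mono[OF K(4) K(4)])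
        finally show False
          by simp
      qed
      then obtain x where x: "x \<in> K" "x \<in> b <# K"
        by blast
      then obtain y where y: "y \<in> K" "x = b \<otimes> y"
        by (auto simp: l_coset_def)
      have "y \<in> carrier G"
        using y(1) K(3) Bc by blast
      then have "b = x \<otimes> inv y"
        using y(2) Bc[OF b] by (simp add: m_assoc)
      then show "b \<in> (\<lambda>(x, y). x \<otimes> inv y) ` (K \<times> K)"
        using x(1) y(1) by (intro image_eqI[of _ _ "(x, y)"]) simp_all
    qed
  qed
  moreover have "compactin T ((\<lambda>(x, y). x \<otimes> inv y) ` (K \<times> K))"
    using K(2) by (intro image_compactin[OF _ continuous_map_division]) (simp add: compactin_Times)
  ultimately have "compactin T B"
    by simp
  then show ?thesis
    using B by (auto simp: compact_open_subgroups_def)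
qed

end

section \<open>Cotrajectories and their growth\<close>

lemma cotrajectory_mono: "U \<subseteq> U' \<Longrightarrow> cotrajectory T \<phi> U n \<subseteq> cotrajectory T \<phi> U' n"
  by (auto simp: cotrajectory_def)

lemma cotrajectory_antimono: "m \<le> n \<Longrightarrow> cotrajectory T \<phi> U n \<subseteq> cotrajectory T \<phi> U m"
  by (auto simp: cotrajectory_def)

lemma cotrajectory_subset: "n > 0 \<Longrightarrow> cotrajectory T \<phi> U n \<subseteq> U"
  by (force simp: cotrajectory_def)

lemma antimono_nat_eventually_constant:
  fixes f :: "nat \<Rightarrow> nat"
  assumes "\<And>n. f (Suc n) \<le> f n"
  obtains N where "\<And>n. n \<ge> N \<Longrightarrow> f n = f N"
proof -
  obtain N where N: "\<And>n. f N \<le> f n"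
    using ex_has_least_nat[of "\<lambda>_. True" 0 f] by blast
  have "f n = f N" if "n \<ge> N" for n
    using N[of n] lift_Suc_antimono_le[of f, OF assms that] by simp
  then show thesis
    by (rule that)
qed

text \<open>
  Constant factors do not change exponential growth rates.
\<close>

lemma growth_rate_le:
  fixes a b :: "nat \<Rightarrow> nat"
  assumes a: "(\<lambda>n. ln (real (a n)) / real n) \<longlonglongrightarrow> \<alpha>" and b: "(\<lambda>n. ln (real (b n)) / real n) \<longlonglongrightarrow> \<beta>"
    and pos: "\<And>n. n > 0 \<Longrightarrow> a n > 0" and le: "\<And>n. n > 0 \<Longrightarrow> a n \<le> k * b n"
  shows "\<alpha> \<le> \<beta>"
proof (rule LIMSEQ_le[OF a])
  show "(\<lambda>n. ln (real k) / real n + ln (real (b n)) / real n) \<longlonglongrightarrow> \<beta>"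
    using tendsto_add[OF lim_const_over_n[of "ln (real k)"] b] by simp
  have "ln (real (a n)) / real n \<le> ln (real k) / real n + ln (real (b n)) / real n" if n: "n > 0" for n
  proof -
    have "0 < k * b n"
      using pos[OF n] le[OF n] by linarith
    then have kb: "k > 0" "b n > 0"
      by auto
    have "ln (real (a n)) \<le> ln (real (k * b n))"
      using pos[OF n] le[OF n] kb by (subst ln_le_cancel_iff) (simp_all del: of_nat_mult)
    also have "\<dots> = ln (real k) + ln (real (b n))"
      using kb by (simp add: ln_mult)
    finally show ?thesis
      by (simp add: add_divide_distrib[symmetric] divide_right_mono)
  qed
  then show "\<exists>N. \<forall>n\<ge>N. ln (real (a n)) / real n \<le> ln (real k) / real n + ln (real (b n)) / real n"
    by (intro exI[of _ 1]) simp
qed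

locale tdlc_abelian_endo = tdlc_abelian_group +
  fixes \<phi> :: "'a \<Rightarrow> 'a"
  assumes endo: "continuous_endo G T \<phi>"
begin

lemma hom_endo: "\<phi> \<in> hom G G"
  and continuous: "continuous_map T T \<phi>"
  using endo by (simp_all add: continuous_endo_def)

lemma hom_iterate: "\<phi> ^^ k \<in> hom G G"
proof (induction k)
  case (Suc k)
  then show ?case
    using hom_endo by (auto simp: hom_def Pi_iff)
qed (simp add: hom_def)

lemma iterate_closed: "x \<in> carrier G \<Longrightarrow> (\<phi> ^^ k) x \<in> carrier G"
  using hom_iterate[of k] by (auto simp: hom_def)

lemma endo_closed: "x \<in> carrier G \<Longrightarrow> \<phi> x \<in> carrier G"
  using hom_endo by (auto simp: hom_def)

lemma iterate_mult:
  "x \<in> carrier G \<Longrightarrow> y \<in> carrier G \<Longrightarrow> (\<phi> ^^ k) (x \<otimes> y) = (\<phi> ^^ k) x \<otimes> (\<phi> ^^ k) y"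
  by (rule hom_mult[OF hom_iterate])

lemma endo_mult: "x \<in> carrier G \<Longrightarrow> y \<in> carrier G \<Longrightarrow> \<phi> (x \<otimes> y) = \<phi> x \<otimes> \<phi> y"
  by (rule hom_mult[OF hom_endo])

lemma endo_inv: "x \<in> carrier G \<Longrightarrow> \<phi> (inv x) = inv (\<phi> x)"
  using group_hom.hom_inv[of G G \<phi>] hom_endo by (simp add: group_hom_def group_hom_axioms_def)

lemma cotrajectory_Suc:
  "cotrajectory T \<phi> U (Suc n) = U \<inter> {x \<in> carrier G. \<phi> x \<in> cotrajectory T \<phi> U n}"
  by (auto simp: cotrajectory_def topspace_eq endo_closed less_Suc_eq_0_disj funpow_swap1)

lemma cotrajectory_subgroup:
  assumes U: "subgroup U G"
  shows "subgroup (cotrajectory T \<phi> U n) G"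
proof (induction n)
  case 0
  then show ?case
    using subgroup_self by (simp add: cotrajectory_def topspace_eq)
next
  case (Suc n)
  then show ?case
    unfolding cotrajectory_Suc using U group_hom.subgroup_vimage[of G G \<phi>] hom_endo
    by (intro subgroups_Inter_pair) (simp_all add: group_hom_def group_hom_axioms_def)
qed

lemma cotrajectory_openin:
  assumes U: "openin T U"
  shows "openin T (cotrajectory T \<phi> U n)"
proof (induction n)
  case 0
  then show ?case
    by (simp add: cotrajectory_def)
next
  case (Suc n)
  then show ?case
    unfolding cotrajectory_Suc using U openin_continuous_map_preimage[OF continuous Suc]
    by (simp add: topspace_eq openin_Int)
qed

lemma cotrajectory_in_compact_open_subgroups:
  assumes "U \<in> compact_open_subgroups G T" "n > 0"
  shows "cotrajectory T \<phi> U n \<in> compact_open_subgroups G T"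
  using assms cotrajectory_subset[of n T \<phi> U] by (intro compact_open_subgroupsI[where U = U])
    (auto simp: compact_open_subgroups_def cotrajectory_subgroup cotrajectory_openin)

lemma cotrajectory_index_pos:
  assumes "U \<in> compact_open_subgroups G T" and "n > 0"
  shows "subgroup_index G (cotrajectory T \<phi> U n) (cotrajectory T \<phi> U m) > 0"
proof (rule subgroup_index_pos)
  show "compactin T (cotrajectory T \<phi> U n)"
    using cotrajectory_in_compact_open_subgroups[OF assms] by (simp add: compact_open_subgroups_def)
qed (use assms in \<open>auto simp: compact_open_subgroups_def cotrajectory_subgroup cotrajectory_openin\<close>)

lemma endo_image_cotrajectory: "\<phi> ` cotrajectory T \<phi> U (Suc n) \<subseteq> cotrajectory T \<phi> U n"
  unfolding cotrajectory_Suc by auto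

text \<open>
  \<open>C\<^sub>n\<^sub>+\<^sub>2\<close> is the preimage of \<open>C\<^sub>n\<^sub>+\<^sub>1\<close> under the restriction of \<open>\<phi>\<close> to \<open>C\<^sub>n\<^sub>+\<^sub>1\<close>, whose image lies in
  \<open>C\<^sub>n\<close>.  This embeds the cosets of \<open>C\<^sub>n\<^sub>+\<^sub>2\<close> in \<open>C\<^sub>n\<^sub>+\<^sub>1\<close> into the cosets of \<open>C\<^sub>n\<^sub>+\<^sub>1\<close> in \<open>C\<^sub>n\<close>, which makes the
  successive indices a decreasing sequence of natural numbers.
\<close>

lemma cotrajectory_index_eq_image:
  assumes U: "subgroup U G" and n: "n > 0"
  shows "subgroup_index G (cotrajectory T \<phi> U (Suc n)) (cotrajectory T \<phi> U (Suc (Suc n)))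
       = subgroup_index G (\<phi> ` cotrajectory T \<phi> U (Suc n)) (cotrajectory T \<phi> U (Suc n))"
proof -
  let ?A = "cotrajectory T \<phi> U (Suc n)"
  have A: "subgroup ?A G"
    by (rule cotrajectory_subgroup[OF U])
  have "\<phi> \<in> hom (G\<lparr>carrier := ?A\<rparr>) G"
    using hom_endo subgroup.subset[OF A] by (auto simp: hom_def)
  moreover have "{x \<in> ?A. \<phi> x \<in> ?A} = cotrajectory T \<phi> U (Suc (Suc n))"
    using cotrajectory_antimono[of "Suc n" "Suc (Suc n)" T \<phi> U] cotrajectory_subset[of "Suc n" T \<phi> U]
      subgroup.subset[OF A] unfolding cotrajectory_Suc[of U "Suc n"] by auto
  ultimately show ?thesis
    using subgroup_index_vimage[OF is_group _ refl A A, of \<phi>] by simp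
qed

lemma cotrajectory_index_Suc_le:
  assumes U: "U \<in> compact_open_subgroups G T" and n: "n > 0"
  shows "subgroup_index G (cotrajectory T \<phi> U (Suc n)) (cotrajectory T \<phi> U (Suc (Suc n)))
       \<le> subgroup_index G (cotrajectory T \<phi> U n) (cotrajectory T \<phi> U (Suc n))"
proof -
  have sU: "subgroup U G"
    using U by (simp add: compact_open_subgroups_def)
  show ?thesis
    unfolding cotrajectory_index_eq_image[OF sU n]
    using subgroup_index_mono(2)[OF endo_image_cotrajectory _ cotrajectory_index_pos[OF U n]]
      subgroup.one_closed[OF cotrajectory_subgroup[OF sU, of "Suc n"]] by auto
qed

lemma cotrajectory_index_stabilizes:
  assumes U: "U \<in> compact_open_subgroups G T"
  obtains N q where "N > 0" "q > 0"
    "\<And>n. n \<ge> N \<Longrightarrow> subgroup_index G (cotrajectory T \<phi> U n) (cotrajectory T \<phi> U (Suc n)) = q"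
proof -
  define f where "f n = subgroup_index G (cotrajectory T \<phi> U (Suc n)) (cotrajectory T \<phi> U (Suc (Suc n)))" for n
  have "f (Suc n) \<le> f n" for n
    unfolding f_def by (rule cotrajectory_index_Suc_le[OF U]) simp
  then obtain N where N: "\<And>n. n \<ge> N \<Longrightarrow> f n = f N"
    using antimono_nat_eventually_constant[of f] by blast
  show thesis
  proof (rule that[of "Suc N" "f N"])
    show "f N > 0"
      unfolding f_def by (rule cotrajectory_index_pos[OF U]) simp
    fix n
    assume "n \<ge> Suc N"
    then show "subgroup_index G (cotrajectory T \<phi> U n) (cotrajectory T \<phi> U (Suc n)) = f N"
      using N[of "n - 1"] by (simp add: f_def)
  qed simp
qed

definition growth_rate :: "'a set \<Rightarrow> real" where
  "growth_rate U = lim (\<lambda>n. ln (real (subgroup_index G U (cotrajectory T \<phi> U n))) / real n)"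

text \<open>
  If the successive indices equal \<open>q\<close> from \<open>N\<close> on, then the index of \<open>C\<^sub>n\<close> in \<open>U\<close> is a constant times
  \<open>q ^ (n - N)\<close>, and its growth rate is the limit \<open>ln q\<close>.  That this is a true limit and not only
  a limes superior is what makes growth rates additive.
\<close>

lemma growth_rate_LIMSEQ:
  assumes U: "U \<in> compact_open_subgroups G T"
  shows "(\<lambda>n. ln (real (subgroup_index G U (cotrajectory T \<phi> U n))) / real n) \<longlonglongrightarrow> growth_rate U"
proof -
  obtain N q where N: "N > 0" and q: "q > 0"
    and Nq: "\<And>n. n \<ge> N \<Longrightarrow> subgroup_index G (cotrajectory T \<phi> U n) (cotrajectory T \<phi> U (Suc n)) = q"
    using cotrajectory_index_stabilizes[OF U] by metis
  let ?C = "cotrajectory T \<phi> U"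
  have sub: "subgroup U G" "subgroup (?C n) G" for n
    using U cotrajectory_subgroup by (auto simp: compact_open_subgroups_def)
  have pos: "subgroup_index G U (?C n) > 0" for n
    using U by (intro subgroup_index_pos) (auto simp: compact_open_subgroups_def sub cotrajectory_openin)
  define a where "a = subgroup_index G U (?C N)"
  have idx: "subgroup_index G U (?C (N + m)) = a * q ^ m" for m
  proof (induction m)
    case (Suc m)
    have "subgroup_index G U (?C (N + Suc m)) = subgroup_index G U (?C (N + m)) * q"
      using N Nq[of "N + m"] cotrajectory_subset[of "N + m" T \<phi> U]
        subgroup_index_mult[OF sub(1) sub(2)[of "N + m"] sub(2)[of "N + Suc m"]]
        cotrajectory_antimono[of "N + m" "N + Suc m" T \<phi> U] by simp
    then show ?case
      using Suc by simp
  qed (simp add: a_def)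
  have "ln (real (subgroup_index G U (?C n))) / real n
      = (ln (real a) - real N * ln (real q)) / real n + ln (real q)" if "n \<ge> N" for n
  proof -
    have "subgroup_index G U (?C n) = a * q ^ (n - N)"
      using idx[of "n - N"] that by simp
    moreover have "a > 0"
      using pos[of N] by (simp add: a_def)
    ultimately show ?thesis
      using q N that by (simp add: ln_mult ln_realpow of_nat_diff field_simps)
  qed
  then have "\<forall>\<^sub>F n in sequentially. (ln (real a) - real N * ln (real q)) / real n + ln (real q)
      = ln (real (subgroup_index G U (?C n))) / real n"
    by (intro eventually_sequentiallyI[of N]) simp
  moreover have "(\<lambda>n. (ln (real a) - real N * ln (real q)) / real n + ln (real q)) \<longlonglongrightarrow> 0 + ln (real q)"
    by (intro tendsto_intros lim_const_over_n)
  ultimately have "(\<lambda>n. ln (real (subgroup_index G U (?C n))) / real n) \<longlonglongrightarrow> 0 + ln (real q)"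
    by (rule Lim_transform_eventually[rotated])
  then show ?thesis
    unfolding growth_rate_def by (simp add: limI)
qed

section \<open>Entropy as the growth rate of indices\<close>

lemma haar_cotrajectory:
  assumes M: "left_haar_measure G T M" and U: "U \<in> compact_open_subgroups G T" and n: "n > 0"
  shows "- ln (measure M (cotrajectory T \<phi> U n))
       = ln (real (subgroup_index G U (cotrajectory T \<phi> U n))) - ln (measure M U)"
    and "measure M (cotrajectory T \<phi> U n) > 0"
proof -
  let ?C = "cotrajectory T \<phi> U n"
  have U': "subgroup U G" "openin T U" "compactin T U"
    using U by (auto simp: compact_open_subgroups_def)
  have C: "subgroup ?C G" "openin T ?C"
    using U' cotrajectory_subgroup cotrajectory_openin by auto
  have eq: "measure M U = real (subgroup_index G U ?C) * measure M ?C"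
    by (rule haar_subgroup_index[OF M U C cotrajectory_subset[OF n]])
  have "measure M U > 0"
    using haar_open_subgroup_pos[OF M U'(1,2)] haar_compact_finite[OF M U'(2,3)]
    by (simp add: measure_def enn2real_positive_iff)
  then show "measure M ?C > 0"
    unfolding eq by (simp add: zero_less_mult_iff)
  then show "- ln (measure M ?C) = ln (real (subgroup_index G U ?C)) - ln (measure M U)"
    using subgroup_index_pos[OF U'(3,1) C] unfolding eq by (simp add: ln_mult)
qed

text \<open>
  A smaller neighbourhood has a smaller cotrajectory and thus a larger entropy.  The absolute value
  in the bound covers those \<open>n\<close> for which the cotrajectory of \<open>W\<close> has real-valued measure 0 by
  convention, being of infinite measure or not measurable; its logarithm is then 0 too.
\<close>

lemma top_entropy_at_le_growth_rate:
  assumes M: "left_haar_measure G T M" and U: "U \<in> compact_open_subgroups G T" and UW: "U \<subseteq> W"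
  shows "top_entropy_at T M \<phi> W \<le> ereal (growth_rate U)"
proof -
  let ?C = "cotrajectory T \<phi>" and ?c = "\<bar>ln (measure M U)\<bar>"
  have U': "subgroup U G" "openin T U" "compactin T U"
    using U by (auto simp: compact_open_subgroups_def)
  have bound: "- ln (measure M (?C W n)) / real n
      \<le> ln (real (subgroup_index G U (?C U n))) / real n + ?c / real n" if n: "n > 0" for n
  proof -
    have idx: "subgroup_index G U (?C U n) > 0"
      using U' by (intro subgroup_index_pos) (auto simp: cotrajectory_subgroup cotrajectory_openin)
    have "- ln (measure M (?C W n)) \<le> ln (real (subgroup_index G U (?C U n))) + ?c"
    proof (cases "?C W n \<in> sets M \<and> emeasure M (?C W n) < \<infinity>")
      case True
      then have "measure M (?C U n) \<le> measure M (?C W n)"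
        using haar_sets[OF M cotrajectory_openin[OF U'(2)]] cotrajectory_mono[OF UW]
        by (intro measure_mono_fmeasurable fmeasurableI) auto
      then have "- ln (measure M (?C W n)) \<le> - ln (measure M (?C U n))"
        using haar_cotrajectory(2)[OF M U n] by simp
      then show ?thesis
        using haar_cotrajectory(1)[OF M U n] by linarith
    next
      case False
      then have "measure M (?C W n) = 0"
        using measure_notin_sets[of "?C W n" M] by (auto simp: measure_def simp flip: less_top)
      then show ?thesis
        using idx by simp
    qed
    from divide_right_mono[OF this, of "real n"] show ?thesis
      by (simp add: add_divide_distrib)
  qed
  have lim: "(\<lambda>n. ln (real (subgroup_index G U (?C U n))) / real n + ?c / real n) \<longlonglongrightarrow> growth_rate U"
    using tendsto_add[OF growth_rate_LIMSEQ[OF U] lim_const_over_n[of ?c]] by simp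
  have "top_entropy_at T M \<phi> W
      \<le> limsup (\<lambda>n. ereal (ln (real (subgroup_index G U (?C U n))) / real n + ?c / real n))"
    unfolding top_entropy_at_def using bound
    by (intro Limsup_mono eventually_sequentiallyI[of 1]) simp
  also have "\<dots> = ereal (growth_rate U)"
    using lim by (intro lim_imp_Limsup) (simp_all add: lim_ereal)
  finally show ?thesis .
qed

lemma top_entropy_at_compact_open_subgroup:
  assumes M: "left_haar_measure G T M" and U: "U \<in> compact_open_subgroups G T"
  shows "top_entropy_at T M \<phi> U = ereal (growth_rate U)"
proof -
  let ?C = "cotrajectory T \<phi> U"
  have "(\<lambda>n. ln (real (subgroup_index G U (?C n))) / real n - ln (measure M U) / real n)
      \<longlonglongrightarrow> growth_rate U"
    using tendsto_diff[OF growth_rate_LIMSEQ[OF U] lim_const_over_n[of "ln (measure M U)"]] by simp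
  moreover have "\<forall>\<^sub>F n in sequentially. ln (real (subgroup_index G U (?C n))) / real n
      - ln (measure M U) / real n = - ln (measure M (?C n)) / real n"
    using haar_cotrajectory(1)[OF M U]
    by (intro eventually_sequentiallyI[of 1]) (simp add: diff_divide_distrib)
  ultimately have "(\<lambda>n. - ln (measure M (?C n)) / real n) \<longlonglongrightarrow> growth_rate U"
    by (rule Lim_transform_eventually)
  then show ?thesis
    unfolding top_entropy_at_def by (intro lim_imp_Limsup) (simp_all add: lim_ereal)
qed

lemma top_entropy_eq_SUP:
  assumes M: "left_haar_measure G T M"
  shows "top_entropy G T M \<phi> = (SUP U\<in>compact_open_subgroups G T. ereal (growth_rate U))"
proof (rule antisym)
  show "(SUP U\<in>compact_open_subgroups G T. ereal (growth_rate U)) \<le> top_entropy G T M \<phi>"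
    unfolding top_entropy_def
  proof (rule SUP_mono)
    fix U
    assume U: "U \<in> compact_open_subgroups G T"
    show "\<exists>W\<in>compact_id_nbhds G T. ereal (growth_rate U) \<le> top_entropy_at T M \<phi> W"
      using top_entropy_at_compact_open_subgroup[OF M U] U compact_open_subgroups_subset_nbhds
      by (intro bexI[of _ U]) auto
  qed
  show "top_entropy G T M \<phi> \<le> (SUP U\<in>compact_open_subgroups G T. ereal (growth_rate U))"
    unfolding top_entropy_def
  proof (rule SUP_mono)
    fix W
    assume "W \<in> compact_id_nbhds G T"
    then obtain V where "openin T V" "\<one> \<in> V" "V \<subseteq> W"
      by (auto simp: compact_id_nbhds_def)
    then obtain U where "U \<in> compact_open_subgroups G T" "U \<subseteq> W"
      using compact_open_subgroup_base[of V] by (metis subset_trans)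
    then show "\<exists>U\<in>compact_open_subgroups G T. top_entropy_at T M \<phi> W \<le> ereal (growth_rate U)"
      using top_entropy_at_le_growth_rate[OF M] by blast
  qed
qed

lemma growth_rate_antimono:
  assumes U: "U \<in> compact_open_subgroups G T" and V: "V \<in> compact_open_subgroups G T" and VU: "V \<subseteq> U"
  shows "growth_rate U \<le> growth_rate V"
proof (rule growth_rate_le[OF growth_rate_LIMSEQ[OF U] growth_rate_LIMSEQ[OF V]])
  fix n :: nat
  assume n: "n > 0"
  let ?C = "cotrajectory T \<phi>"
  have U': "subgroup U G" "openin T U" "compactin T U" and V': "subgroup V G" "openin T V" "compactin T V"
    using U V by (auto simp: compact_open_subgroups_def)
  note C = cotrajectory_subgroup[OF U'(1), of n] cotrajectory_subgroup[OF V'(1), of n]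
  have "0 < subgroup_index G U (?C V n)"
    by (rule subgroup_index_pos[OF U'(3,1) C(2) cotrajectory_openin[OF V'(2)]])
  note * = subgroup_index_antimono[OF U'(1) C cotrajectory_mono[OF VU] cotrajectory_subset[OF n] this]
  show "0 < subgroup_index G U (?C U n)"
    by (rule *(1))
  show "subgroup_index G U (?C U n) \<le> subgroup_index G U V * subgroup_index G V (?C V n)"
    using *(2) subgroup_index_mult[OF U'(1) V'(1) C(2) cotrajectory_subset[OF n] VU] by simp
qed

section \<open>Solving the perturbed recursion inside a subgroup\<close>

text \<open>
  When two successive indices agree, the embedding of cosets given by \<open>\<phi>\<close> is onto, so \<open>C\<^sub>n\<close> is the
  product of \<open>\<phi> ` C\<^sub>n\<^sub>+\<^sub>1\<close> and \<open>C\<^sub>n\<^sub>+\<^sub>1\<close>.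
\<close>

lemma cotrajectory_split:
  assumes U: "U \<in> compact_open_subgroups G T" and n: "n > 0"
    and eq: "subgroup_index G (cotrajectory T \<phi> U (Suc n)) (cotrajectory T \<phi> U (Suc (Suc n)))
           = subgroup_index G (cotrajectory T \<phi> U n) (cotrajectory T \<phi> U (Suc n))"
    and x: "x \<in> cotrajectory T \<phi> U n"
  shows "\<exists>y\<in>cotrajectory T \<phi> U (Suc n). \<exists>z\<in>cotrajectory T \<phi> U (Suc n). x = \<phi> y \<otimes> z"
proof -
  let ?C = "cotrajectory T \<phi> U"
  have sU: "subgroup U G"
    using U by (simp add: compact_open_subgroups_def)
  note C = cotrajectory_subgroup[OF sU] subgroup.mem_carrier[OF cotrajectory_subgroup[OF sU]]
  obtain a where a: "a \<in> \<phi> ` ?C (Suc n)" "a <# ?C (Suc n) = x <# ?C (Suc n)"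
    by (rule cosets_meet_of_index_eq[OF endo_image_cotrajectory cotrajectory_index_pos[OF U n] _ x])
      (use eq cotrajectory_index_eq_image[OF sU n] in simp_all)
  obtain y where y: "y \<in> ?C (Suc n)" "a = \<phi> y"
    using a by auto
  have c: "\<phi> y \<in> carrier G" "x \<in> carrier G"
    using C(2)[OF y(1)] C(2)[OF x] endo_closed by auto
  have "inv (\<phi> y) \<otimes> x \<in> ?C (Suc n)"
    using a(2) c y(2) lcoset_eq_iff[OF C(1)] by simp
  moreover have "x = \<phi> y \<otimes> (inv (\<phi> y) \<otimes> x)"
    using c by (simp add: m_assoc[symmetric])
  ultimately show ?thesis
    using y(1) by blast
qed

lemma funpow_mem_cotrajectory:
  assumes "x \<in> cotrajectory T \<phi> U n" "m + k \<le> n"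
  shows "(\<phi> ^^ k) x \<in> cotrajectory T \<phi> U m"
proof -
  have "(\<phi> ^^ (i + k)) x \<in> U" if "i < m" for i
    using assms that by (simp add: cotrajectory_def)
  then show ?thesis
    using assms(1) iterate_closed by (simp add: cotrajectory_def topspace_eq funpow_add)
qed

text \<open>
  A finite-horizon form of Willis' tidiness above: each element of \<open>V\<close> is a product of one that
  has a backward orbit of length \<open>m\<close> in \<open>V\<close> (through \<open>y\<close>) and one that has a forward orbit of
  length \<open>m\<close> in \<open>V\<close> (namely \<open>z\<close>).  With \<open>V = C\<^sub>N\<close> for an \<open>N\<close> from which the successive indices
  are constant, this results from iterating the factorization \<open>C\<^sub>n = \<phi>(C\<^sub>n\<^sub>+\<^sub>1) C\<^sub>n\<^sub>+\<^sub>1\<close>: on the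
  first factor it lengthens the backward orbit, on the second one the forward orbit.
\<close>

lemma exists_factorizing_subgroup:
  assumes U: "U \<in> compact_open_subgroups G T"
  obtains V where "V \<in> compact_open_subgroups G T" "V \<subseteq> U"
    "\<And>m x. x \<in> V \<Longrightarrow> \<exists>y z. y \<in> carrier G \<and> z \<in> carrier G \<and> x = (\<phi> ^^ m) y \<otimes> z \<and>
        (\<forall>i\<le>m. (\<phi> ^^ i) y \<in> V \<and> (\<phi> ^^ i) z \<in> V)"
proof -
  let ?C = "cotrajectory T \<phi> U"
  have sU: "subgroup U G"
    using U by (simp add: compact_open_subgroups_def)
  note C = cotrajectory_subgroup[OF sU]
  have Cc: "x \<in> carrier G" if "x \<in> ?C n" for x n
    using subgroup.mem_carrier[OF C that] .
  obtain N q where N: "N > 0"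
    and q: "\<And>n. n \<ge> N \<Longrightarrow> subgroup_index G (?C n) (?C (Suc n)) = q"
    using cotrajectory_index_stabilizes[OF U] by metis
  have 1: "\<exists>y\<in>?C (Suc n). \<exists>z\<in>?C (Suc n). x = \<phi> y \<otimes> z" if "n \<ge> N" "x \<in> ?C n" for n x
    using cotrajectory_split[OF U, of n x] q[of n] q[of "Suc n"] that N by simp
  have 2: "\<exists>y\<in>?C (n + m). \<exists>z\<in>?C (Suc n). x = (\<phi> ^^ m) y \<otimes> z" if n: "n \<ge> N" and x: "x \<in> ?C n" for n m x
  proof (induction m)
    case 0
    show ?case
      using x subgroup.one_closed[OF C] Cc[OF x] by (intro bexI[of _ x] bexI[of _ \<one>]) auto
  next
    case (Suc m)
    then obtain y z where yz: "y \<in> ?C (n + m)" "z \<in> ?C (Suc n)" "x = (\<phi> ^^ m) y \<otimes> z"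
      by blast
    then obtain y' z' where yz': "y' \<in> ?C (Suc (n + m))" "z' \<in> ?C (Suc (n + m))" "y = \<phi> y' \<otimes> z'"
      using 1[of "n + m" y] n by auto
    note c = Cc[OF yz(2)] Cc[OF yz'(1)] Cc[OF yz'(2)]
    have "(\<phi> ^^ m) z' \<in> ?C (Suc n)"
      using funpow_mem_cotrajectory[OF yz'(2), of "Suc n" m] by simp
    then have "(\<phi> ^^ m) z' \<otimes> z \<in> ?C (Suc n)"
      using yz(2) C by (simp add: subgroup.m_closed)
    moreover have "x = (\<phi> ^^ Suc m) y' \<otimes> ((\<phi> ^^ m) z' \<otimes> z)"
      using yz(3) yz'(3) c by (simp add: iterate_mult endo_closed iterate_closed m_assoc funpow_swap1)
    ultimately show ?case
      using yz'(1) by (metis add_Suc_right)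
  qed
  have 3: "\<exists>y\<in>?C (N + m). \<exists>z\<in>?C (N + j). x = (\<phi> ^^ m) y \<otimes> z" if x: "x \<in> ?C N" for m j x
  proof (induction j)
    case 0
    show ?case
      using x subgroup.one_closed[OF C] Cc[OF x] hom_one[OF hom_iterate is_group is_group, of m]
      by (intro bexI[of _ \<one>] bexI[of _ x]) auto
  next
    case (Suc j)
    then obtain y z where yz: "y \<in> ?C (N + m)" "z \<in> ?C (N + j)" "x = (\<phi> ^^ m) y \<otimes> z"
      by blast
    then obtain y' z' where yz': "y' \<in> ?C (N + j + m)" "z' \<in> ?C (Suc (N + j))" "z = (\<phi> ^^ m) y' \<otimes> z'"
      using 2[of "N + j" z m] by auto
    note c = Cc[OF yz(1)] Cc[OF yz'(1)] Cc[OF yz'(2)]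
    have "y' \<in> ?C (N + m)"
      using yz'(1) cotrajectory_antimono[of "N + m" "N + j + m" T \<phi> U] by auto
    then have "y \<otimes> y' \<in> ?C (N + m)"
      using yz(1) C by (simp add: subgroup.m_closed)
    moreover have "x = (\<phi> ^^ m) (y \<otimes> y') \<otimes> z'"
      using yz(3) yz'(3) c by (simp add: iterate_mult iterate_closed m_assoc)
    ultimately show ?case
      using yz'(2) by (metis add_Suc_right)
  qed
  show thesis
  proof (rule that[of "?C N"])
    show "?C N \<in> compact_open_subgroups G T" "?C N \<subseteq> U"
      using cotrajectory_in_compact_open_subgroups[OF U N] cotrajectory_subset[OF N, of T \<phi> U] by auto
    fix m x
    assume "x \<in> ?C N"
    then obtain y z where yz: "y \<in> ?C (N + m)" "z \<in> ?C (N + m)" "x = (\<phi> ^^ m) y \<otimes> z"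
      using 3[of x m m] by blast
    then show "\<exists>y z. y \<in> carrier G \<and> z \<in> carrier G \<and> x = (\<phi> ^^ m) y \<otimes> z \<and>
        (\<forall>i\<le>m. (\<phi> ^^ i) y \<in> ?C N \<and> (\<phi> ^^ i) z \<in> ?C N)"
      using Cc funpow_mem_cotrajectory[of _ U "N + m" N] by (intro exI[of _ y] exI[of _ z]) auto
  qed
qed

text \<open>
  The recursion is solved for one perturbation \<open>b j\<close> at a time; since the group is abelian, the
  solutions multiply.  The perturbation \<open>b j = \<phi>\<^sup>n(y) z\<close> is absorbed by following the forward orbit
  of \<open>z\<close> after time \<open>j\<close> and the inverse of the backward orbit of \<open>\<phi>\<^sup>n(y)\<close> up to time \<open>j\<close>.
  Neither orbit leaves \<open>V\<close>.
\<close>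

lemma perturbed_orbit_in_subgroup:
  assumes V: "subgroup V G"
    and split: "\<And>m x. x \<in> V \<Longrightarrow> \<exists>y z. y \<in> carrier G \<and> z \<in> carrier G \<and> x = (\<phi> ^^ m) y \<otimes> z \<and>
        (\<forall>i\<le>m. (\<phi> ^^ i) y \<in> V \<and> (\<phi> ^^ i) z \<in> V)"
    and b: "\<And>k. k < n \<Longrightarrow> b k \<in> V"
  shows "\<exists>w. (\<forall>k\<le>n. w k \<in> V) \<and> (\<forall>k<n. w (Suc k) = \<phi> (w k) \<otimes> b k)"
proof -
  have Vc: "x \<in> carrier G" if "x \<in> V" for x
    using subgroup.mem_carrier[OF V that] .
  have single: "\<exists>w. (\<forall>k\<le>n. w k \<in> V) \<and> (\<forall>k<n. w (Suc k) = \<phi> (w k) \<otimes> (if k = j then x else \<one>))"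
    if j: "j < n" and x: "x \<in> V" for j x
  proof -
    obtain y z where yz: "y \<in> carrier G" "z \<in> carrier G" "x = (\<phi> ^^ n) y \<otimes> z"
      and V': "\<And>i. i \<le> n \<Longrightarrow> (\<phi> ^^ i) y \<in> V" "\<And>i. i \<le> n \<Longrightarrow> (\<phi> ^^ i) z \<in> V"
      using split[OF x, of n] by blast
    define w where "w k = (if k \<le> j then inv ((\<phi> ^^ (n - 1 - (j - k))) y) else (\<phi> ^^ (k - Suc j)) z)" for k
    have "w k \<in> V" if "k \<le> n" for k
      using that V' j subgroup.m_inv_closed[OF V] by (auto simp: w_def)
    moreover have "w (Suc k) = \<phi> (w k) \<otimes> (if k = j then x else \<one>)" if k: "k < n" for k
    proof (cases k j rule: linorder_cases)
      case less
      then have "n - 1 - (j - Suc k) = Suc (n - 1 - (j - k))"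
        using j by simp
      then show ?thesis
        using less yz by (simp add: w_def endo_inv iterate_closed endo_closed)
    next
      case equal
      have "\<phi> (w k) = inv ((\<phi> ^^ n) y)"
        using equal yz j endo_inv[of "(\<phi> ^^ (n - 1)) y"] funpow.simps(2)[of "n - 1" \<phi>]
        by (simp add: w_def iterate_closed)
      then show ?thesis
        using equal yz by (simp add: w_def iterate_closed m_assoc[symmetric])
    next
      case greater
      then have "Suc k - Suc j = Suc (k - Suc j)"
        by simp
      then show ?thesis
        using greater yz by (simp add: w_def iterate_closed endo_closed)
    qed
    ultimately show ?thesis
      by blast
  qed
  have "\<exists>w. (\<forall>k\<le>n. w k \<in> V) \<and> (\<forall>k<n. w (Suc k) = \<phi> (w k) \<otimes> (if k < j then b k else \<one>))" if "j \<le> n" for j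
    using that
  proof (induction j)
    case 0
    show ?case
      using subgroup.one_closed[OF V] hom_one[OF hom_endo is_group is_group]
      by (intro exI[of _ "\<lambda>_. \<one>"]) simp
  next
    case (Suc j)
    then obtain w where w: "\<And>k. k \<le> n \<Longrightarrow> w k \<in> V"
      "\<And>k. k < n \<Longrightarrow> w (Suc k) = \<phi> (w k) \<otimes> (if k < j then b k else \<one>)"
      by auto
    obtain v where v: "\<And>k. k \<le> n \<Longrightarrow> v k \<in> V"
      "\<And>k. k < n \<Longrightarrow> v (Suc k) = \<phi> (v k) \<otimes> (if k = j then b j else \<one>)"
      using single[of j "b j"] b[of j] Suc.prems by auto
    have "w (Suc k) \<otimes> v (Suc k) = \<phi> (w k \<otimes> v k) \<otimes> (if k < Suc j then b k else \<one>)" if k: "k < n" for k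
    proof -
      have c: "w k \<in> carrier G" "v k \<in> carrier G" "b k \<in> carrier G"
        using w(1)[of k] v(1)[of k] b[OF k] Vc k by auto
      show ?thesis
        using w(2)[OF k] v(2)[OF k] c by (auto simp: endo_mult endo_closed m_ac less_Suc_eq)
    qed
    then show ?case
      using w(1) v(1) subgroup.m_closed[OF V] by (intro exI[of _ "\<lambda>k. w k \<otimes> v k"]) auto
  qed
  from this[of n] show ?thesis
    by auto
qed

end

section \<open>Invariant closed subgroups and their quotients\<close>

lemma (in comm_group) divide_mult_divide_cancel:
  assumes "a \<in> carrier G" "b \<in> carrier G" "c \<in> carrier G"
  shows "a \<otimes> inv (b \<otimes> (a \<otimes> inv c)) = c \<otimes> inv b"
proof -
  have "a \<otimes> (c \<otimes> (d \<otimes> e)) = (a \<otimes> d) \<otimes> (c \<otimes> e)" if "d \<in> carrier G" "e \<in> carrier G" for d e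
    using assms that by (simp add: m_ac)
  from this[of "inv a" "inv b"] show ?thesis
    using assms by (simp add: inv_mult m_ac)
qed

lemma (in comm_group) mult_divide_divide_cancel:
  assumes "a \<in> carrier G" "b \<in> carrier G" "c \<in> carrier G"
  shows "a \<otimes> b \<otimes> inv (b \<otimes> inv c) = a \<otimes> c"
proof -
  have "b \<otimes> (a \<otimes> (c \<otimes> d)) = (b \<otimes> d) \<otimes> (a \<otimes> c)" if "d \<in> carrier G" for d
    using assms that by (simp add: m_ac)
  from this[of "inv b"] show ?thesis
    using assms by (simp add: inv_mult m_ac)
qed

locale tdlc_abelian_invariant_subgroup = tdlc_abelian_endo +
  fixes H :: "'a set"
  assumes subgroup_H: "subgroup H G"
    and closedin_H: "closedin T H"
    and invariant_H: "\<phi> ` H \<subseteq> H"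
begin

lemma mem_H_carrier: "x \<in> H \<Longrightarrow> x \<in> carrier G"
  by (rule subgroup.mem_carrier[OF subgroup_H])

lemma subgroup_Int_H: "subgroup B G \<Longrightarrow> subgroup (B \<inter> H) (G\<lparr>carrier := H\<rparr>)"
  using subgroup_H subgroups_Inter_pair by (intro subgroup_incl) auto

lemma openin_Int_H: "openin T W \<Longrightarrow> openin (subtopology T H) (W \<inter> H)"
  by (auto simp: openin_subtopology)

lemma compact_open_subgroups_Int_H:
  assumes "U \<in> compact_open_subgroups G T"
  shows "U \<inter> H \<in> compact_open_subgroups (G\<lparr>carrier := H\<rparr>) (subtopology T H)"
  using assms subgroup_Int_H openin_Int_H compact_Int_closedin[OF _ closedin_H]
  by (auto simp: compact_open_subgroups_def compactin_subtopology)

lemma open_subgroup_of_H: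
  assumes B': "subgroup B' (G\<lparr>carrier := H\<rparr>)" "openin (subtopology T H) B'"
  obtains B where "B \<in> compact_open_subgroups G T" "B \<inter> H \<subseteq> B'"
proof -
  obtain W where W: "openin T W" "B' = W \<inter> H"
    using B'(2) by (auto simp: openin_subtopology)
  have "\<one> \<in> W"
    using subgroup.one_closed[OF B'(1)] W(2) by simp
  then obtain B where "B \<in> compact_open_subgroups G T" "B \<subseteq> W"
    using compact_open_subgroup_base[OF W(1)] by blast
  then show thesis
    using that W(2) by blast
qed

lemma tdlc_abelian_endo_subgroup:
  "tdlc_abelian_endo (G\<lparr>carrier := H\<rparr>) (subtopology T H) (restrict \<phi> H)"
proof -
  interpret H: group "G\<lparr>carrier := H\<rparr>"
    by (rule subgroup.subgroup_is_group[OF subgroup_H is_group])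
  have comm: "comm_group (G\<lparr>carrier := H\<rparr>)"
    using mem_H_carrier m_comm by (intro H.group_comm_groupI) simp
  have HT: "H \<subseteq> topspace T"
    using closedin_H by (rule closedin_subset)
  have nonarch: "nonarchimedean_group (G\<lparr>carrier := H\<rparr>) (subtopology T H)"
  proof (intro nonarchimedean_group.intro comm nonarchimedean_group_axioms.intro)
    show "topspace (subtopology T H) = carrier (G\<lparr>carrier := H\<rparr>)"
      using HT by (auto simp: topspace_subtopology)
  next
    fix W x
    assume "openin (subtopology T H) W" and x: "x \<in> W"
    then obtain W' where W': "openin T W'" "W = W' \<inter> H"
      by (auto simp: openin_subtopology)
    then obtain B where B: "subgroup B G" "openin T B" "x <# B \<subseteq> W'"
      using open_subgroup_base[of W' x] x by auto
    have "x <# (B \<inter> H) \<subseteq> x <# B" "x <# (B \<inter> H) \<subseteq> H"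
      using lcoset_subset[OF subgroup_H, of "B \<inter> H" x] x W' by (auto simp: l_coset_def)
    then show "\<exists>B. subgroup B (G\<lparr>carrier := H\<rparr>) \<and> openin (subtopology T H) B
        \<and> x <#\<^bsub>G\<lparr>carrier := H\<rparr>\<^esub> B \<subseteq> W"
      using B W' subgroup_Int_H openin_Int_H
      by (intro exI[of _ "B \<inter> H"]) (auto simp: lcoset_subset_cong)
  next
    fix B' x
    assume B': "subgroup B' (G\<lparr>carrier := H\<rparr>)" "openin (subtopology T H) B'"
      and "x \<in> carrier (G\<lparr>carrier := H\<rparr>)"
    then have x: "x \<in> H"
      by simp
    obtain B where B: "B \<in> compact_open_subgroups G T" "B \<inter> H \<subseteq> B'"
      by (rule open_subgroup_of_H[OF B'])
    have BG: "subgroup B G" "openin T B"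
      using B by (auto simp: compact_open_subgroups_def)
    have B'G: "subgroup B' G" and B'H: "B' \<subseteq> H"
      using incl_subgroup[OF subgroup_H B'(1)] subgroup.subset[OF B'(1)] by auto
    define W where "W = (\<Union>y\<in>x <# B'. y <# B)"
    have sub: "x <# B' \<subseteq> H"
      by (rule lcoset_subset[OF subgroup_H B'H x])
    have "openin T W"
      unfolding W_def using openin_lcoset[OF BG] sub mem_H_carrier by (intro openin_Union) auto
    moreover have "x <# B' = W \<inter> H"
    proof
      show "x <# B' \<subseteq> W \<inter> H"
        using sub mem_lcoset_self[OF BG(1)] mem_H_carrier by (auto simp: W_def)
      show "W \<inter> H \<subseteq> x <# B'"
      proof
        fix z
        assume "z \<in> W \<inter> H"
        then obtain c b where cb: "c \<in> B'" "b \<in> B" "z = x \<otimes> c \<otimes> b" and z: "z \<in> H"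
          by (auto simp: W_def l_coset_def)
        have c: "x \<in> carrier G" "c \<in> carrier G" "b \<in> carrier G"
          using x cb B'H mem_H_carrier subgroup.mem_carrier[OF BG(1)] by auto
        have "inv (x \<otimes> c) \<otimes> z = b"
          unfolding cb(3) using c m_assoc[of "inv (x \<otimes> c)" "x \<otimes> c" b] by simp
        moreover have "inv (x \<otimes> c) \<otimes> z \<in> H"
          using x cb(1) B'H z subgroup_H
          by (auto intro!: subgroup.m_closed[OF subgroup_H] subgroup.m_inv_closed[OF subgroup_H])
        ultimately have "c \<otimes> b \<in> B'"
          using B(2) cb subgroup.m_closed[OF B'G] by auto
        moreover have "z = x \<otimes> (c \<otimes> b)"
          using cb(3) c by (simp add: m_assoc)
        ultimately show "z \<in> x <# B'"
          by (auto simp: l_coset_def)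
      qed
    qed
    ultimately show "openin (subtopology T H) (x <#\<^bsub>G\<lparr>carrier := H\<rparr>\<^esub> B')"
      unfolding lcoset_subset_cong using openin_Int_H by simp
  qed
  have "compact_open_subgroups (G\<lparr>carrier := H\<rparr>) (subtopology T H) \<noteq> {}"
    using compact_open_subgroups_nonempty compact_open_subgroups_Int_H by blast
  moreover have "continuous_endo (G\<lparr>carrier := H\<rparr>) (subtopology T H) (restrict \<phi> H)"
    unfolding continuous_endo_def
  proof
    show "restrict \<phi> H \<in> hom (G\<lparr>carrier := H\<rparr>) (G\<lparr>carrier := H\<rparr>)"
      using invariant_H endo_mult mem_H_carrier subgroup.m_closed[OF subgroup_H]
      by (intro homI) auto
    have "continuous_map (subtopology T H) (subtopology T H) \<phi>"
      using continuous invariant_H HT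
      by (auto simp: continuous_map_in_subtopology intro: continuous_map_from_subtopology)
    then show "continuous_map (subtopology T H) (subtopology T H) (restrict \<phi> H)"
      by (rule continuous_map_eq) auto
  qed
  ultimately show ?thesis
    using nonarch by (simp add: tdlc_abelian_endo_def tdlc_abelian_group_def
        tdlc_abelian_group_axioms_def tdlc_abelian_endo_axioms_def)
qed

sublocale Sub: tdlc_abelian_endo "G\<lparr>carrier := H\<rparr>" "subtopology T H" "restrict \<phi> H"
  by (rule tdlc_abelian_endo_subgroup)

lemma restrict_iterate: "x \<in> H \<Longrightarrow> (restrict \<phi> H ^^ k) x = (\<phi> ^^ k) x \<and> (\<phi> ^^ k) x \<in> H"
  using invariant_H by (induction k) auto

lemma cotrajectory_Int_H:
  "cotrajectory (subtopology T H) (restrict \<phi> H) (U \<inter> H) n = cotrajectory T \<phi> U n \<inter> H"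
  using restrict_iterate by (auto simp: cotrajectory_def)

abbreviation \<pi> :: "'a \<Rightarrow> 'a set" where
  "\<pi> x \<equiv> H #> x"

abbreviation TQ :: "'a set topology" where
  "TQ \<equiv> quotient_topology G T H"

abbreviation \<phi>Q :: "'a set \<Rightarrow> 'a set" where
  "\<phi>Q \<equiv> induced_endo G H \<phi>"

lemma group_hom_\<pi>: "group_hom G (G Mod H) \<pi>"
proof -
  have nH: "H \<lhd> G"
    using subgroup_H normal_iff_subgroup by simp
  show ?thesis
    using normal.factorgroup_is_group[OF nH] normal.r_coset_hom_Mod[OF nH]
    by (simp add: group_hom_def group_hom_axioms_def)
qed

lemma \<pi>_mult: "x \<in> carrier G \<Longrightarrow> y \<in> carrier G \<Longrightarrow> \<pi> (x \<otimes> y) = \<pi> x \<otimes>\<^bsub>G Mod H\<^esub> \<pi> y"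
  by (rule group_hom.hom_mult[OF group_hom_\<pi>])

lemma \<pi>_eq_iff: "x \<in> carrier G \<Longrightarrow> y \<in> carrier G \<Longrightarrow> \<pi> x = \<pi> y \<longleftrightarrow> inv x \<otimes> y \<in> H"
  using lcoset_eq_iff[OF subgroup_H] by (simp flip: lcoset_eq_rcoset[OF subgroup_H])

lemma carrier_Q: "carrier (G Mod H) = \<pi> ` carrier G"
  by (rule carrier_FactGroup)

lemma \<phi>Q_\<pi>: "x \<in> carrier G \<Longrightarrow> \<phi>Q (\<pi> x) = \<pi> (\<phi> x)"
  by (rule induced_endo_r_coset[OF hom_endo subgroup_H invariant_H])

lemma quotient_map_\<pi>: "quotient_map T TQ \<pi>"
  by (rule quotient_map_quotient_topology[OF topspace_eq])

lemma topspace_Q: "topspace TQ = carrier (G Mod H)"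
  using quotient_imp_surjective_map[OF quotient_map_\<pi>] by (simp add: topspace_eq carrier_Q)

lemma openin_Q_iff: "openin TQ W \<longleftrightarrow> W \<subseteq> carrier (G Mod H) \<and> openin T {x \<in> carrier G. \<pi> x \<in> W}"
  by (simp add: openin_quotient_topology topspace_eq)

lemma lcoset_Q_\<pi>:
  assumes "x \<in> carrier G" "B \<subseteq> carrier G"
  shows "\<pi> x <#\<^bsub>G Mod H\<^esub> (\<pi> ` B) = \<pi> ` (x <# B)"
  using assms(1) subsetD[OF assms(2)]
  by (simp add: l_coset_def image_UN \<pi>_mult del: mult_FactGroup cong: SUP_cong)

lemma openin_image_\<pi>:
  assumes B: "subgroup B G" "openin T B"
  shows "openin TQ (\<pi> ` B)"
  unfolding openin_Q_iff
proof
  have sQ: "subgroup (\<pi> ` B) (G Mod H)"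
    by (rule group_hom.subgroup_img_is_subgroup[OF group_hom_\<pi> B(1)])
  then show "\<pi> ` B \<subseteq> carrier (G Mod H)"
    by (rule subgroup.subset)
  show "openin T {x \<in> carrier G. \<pi> x \<in> \<pi> ` B}"
  proof (rule openin_saturated[OF B])
    fix x b
    assume x: "x \<in> {x \<in> carrier G. \<pi> x \<in> \<pi> ` B}" and b: "b \<in> B"
    then have "\<pi> x \<otimes>\<^bsub>G Mod H\<^esub> \<pi> b \<in> \<pi> ` B"
      using subgroup.m_closed[OF sQ] by blast
    then show "x \<otimes> b \<in> {x \<in> carrier G. \<pi> x \<in> \<pi> ` B}"
      using x b subgroup.mem_carrier[OF B(1)] by (simp add: \<pi>_mult del: mult_FactGroup)
  qed auto
qed

lemma compact_open_subgroups_image_\<pi>: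
  assumes "U \<in> compact_open_subgroups G T"
  shows "\<pi> ` U \<in> compact_open_subgroups (G Mod H) TQ"
  using assms openin_image_\<pi> group_hom.subgroup_img_is_subgroup[OF group_hom_\<pi>]
    image_compactin[OF _ quotient_imp_continuous_map[OF quotient_map_\<pi>]]
  by (simp add: compact_open_subgroups_def)

lemma tdlc_abelian_endo_quotient: "tdlc_abelian_endo (G Mod H) TQ \<phi>Q"
proof -
  interpret \<pi>: group_hom G "G Mod H" \<pi>
    by (rule group_hom_\<pi>)
  have nonarch: "nonarchimedean_group (G Mod H) TQ"
  proof (intro nonarchimedean_group.intro nonarchimedean_group_axioms.intro
      abelian_FactGroup[OF subgroup_H] topspace_Q)
    fix W X
    assume W: "openin TQ W" and X: "X \<in> W"
    then obtain x where x: "x \<in> carrier G" "X = \<pi> x"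
      by (auto simp: openin_Q_iff carrier_Q)
    then obtain B where B: "subgroup B G" "openin T B" "x <# B \<subseteq> {x \<in> carrier G. \<pi> x \<in> W}"
      using open_subgroup_base[of "{x \<in> carrier G. \<pi> x \<in> W}" x] W X by (auto simp: openin_Q_iff)
    show "\<exists>B. subgroup B (G Mod H) \<and> openin TQ B \<and> X <#\<^bsub>G Mod H\<^esub> B \<subseteq> W"
    proof (intro exI conjI)
      show "subgroup (\<pi> ` B) (G Mod H)"
        by (rule \<pi>.subgroup_img_is_subgroup[OF B(1)])
      show "openin TQ (\<pi> ` B)"
        by (rule openin_image_\<pi>[OF B(1,2)])
      show "X <#\<^bsub>G Mod H\<^esub> (\<pi> ` B) \<subseteq> W"
        unfolding x(2) lcoset_Q_\<pi>[OF x(1) subgroup.subset[OF B(1)]] using B(3) by auto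
    qed
  next
    fix B' X
    assume B': "subgroup B' (G Mod H)" "openin TQ B'" and X: "X \<in> carrier (G Mod H)"
    define B where "B = {x \<in> carrier G. \<pi> x \<in> B'}"
    have B: "subgroup B G" "openin T B"
      using \<pi>.subgroup_vimage[OF B'(1)] B'(2) by (auto simp: B_def openin_Q_iff)
    show "openin TQ (X <#\<^bsub>G Mod H\<^esub> B')"
      unfolding openin_Q_iff
    proof
      show "X <#\<^bsub>G Mod H\<^esub> B' \<subseteq> carrier (G Mod H)"
        using \<pi>.H.l_coset_subset_G[OF subgroup.subset[OF B'(1)] X] .
      show "openin T {x \<in> carrier G. \<pi> x \<in> X <#\<^bsub>G Mod H\<^esub> B'}"
      proof (rule openin_saturated[OF B])
        fix x b
        assume x: "x \<in> {x \<in> carrier G. \<pi> x \<in> X <#\<^bsub>G Mod H\<^esub> B'}" and b: "b \<in> B"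
        then obtain c where c: "c \<in> B'" "\<pi> x = X \<otimes>\<^bsub>G Mod H\<^esub> c"
          by (auto simp: l_coset_def)
        have b': "b \<in> carrier G" "\<pi> b \<in> B'"
          using b by (auto simp: B_def)
        have "\<pi> (x \<otimes> b) = X \<otimes>\<^bsub>G Mod H\<^esub> (c \<otimes>\<^bsub>G Mod H\<^esub> \<pi> b)"
          using x b' c X subgroup.mem_carrier[OF B'(1)]
          by (simp add: \<pi>_mult \<pi>.H.m_assoc del: mult_FactGroup)
        moreover have "c \<otimes>\<^bsub>G Mod H\<^esub> \<pi> b \<in> B'"
          using subgroup.m_closed[OF B'(1) c(1) b'(2)] .
        ultimately have "\<pi> (x \<otimes> b) \<in> X <#\<^bsub>G Mod H\<^esub> B'"
          unfolding l_coset_def by blast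
        then show "x \<otimes> b \<in> {x \<in> carrier G. \<pi> x \<in> X <#\<^bsub>G Mod H\<^esub> B'}"
          using x b' by simp
      qed auto
    qed
  qed
  have "compact_open_subgroups (G Mod H) TQ \<noteq> {}"
    using compact_open_subgroups_nonempty compact_open_subgroups_image_\<pi> by blast
  moreover have "continuous_endo (G Mod H) TQ \<phi>Q"
    unfolding continuous_endo_def
  proof
    show "\<phi>Q \<in> hom (G Mod H) (G Mod H)"
    proof (rule homI)
      fix X
      assume "X \<in> carrier (G Mod H)"
      then show "\<phi>Q X \<in> carrier (G Mod H)"
        using endo_closed by (auto simp: carrier_Q \<phi>Q_\<pi>)
    next
      fix X Y
      assume "X \<in> carrier (G Mod H)" "Y \<in> carrier (G Mod H)"
      then obtain x y where xy: "x \<in> carrier G" "X = \<pi> x" "y \<in> carrier G" "Y = \<pi> y"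
        by (auto simp: carrier_Q)
      have "\<phi>Q (\<pi> x \<otimes>\<^bsub>G Mod H\<^esub> \<pi> y) = \<phi>Q (\<pi> (x \<otimes> y))"
        by (simp only: \<pi>_mult[OF xy(1,3)])
      also have "\<dots> = \<pi> (\<phi> x \<otimes> \<phi> y)"
        by (simp only: \<phi>Q_\<pi>[OF m_closed[OF xy(1,3)]] endo_mult[OF xy(1,3)])
      also have "\<dots> = \<phi>Q X \<otimes>\<^bsub>G Mod H\<^esub> \<phi>Q Y"
        using xy by (simp add: \<phi>Q_\<pi> \<pi>_mult endo_closed del: mult_FactGroup)
      finally show "\<phi>Q (X \<otimes>\<^bsub>G Mod H\<^esub> Y) = \<phi>Q X \<otimes>\<^bsub>G Mod H\<^esub> \<phi>Q Y"
        using xy by simp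
    qed
    show "continuous_map TQ TQ \<phi>Q"
    proof (rule continuous_compose_quotient_map[OF quotient_map_\<pi>])
      have "continuous_map T TQ (\<pi> \<circ> \<phi>)"
        using continuous_map_compose[OF continuous quotient_imp_continuous_map[OF quotient_map_\<pi>]] .
      then show "continuous_map T TQ (\<phi>Q \<circ> \<pi>)"
        by (rule continuous_map_eq) (simp add: topspace_eq \<phi>Q_\<pi>)
    qed
  qed
  ultimately show ?thesis
    using nonarch by (simp add: tdlc_abelian_endo_def tdlc_abelian_group_def
        tdlc_abelian_group_axioms_def tdlc_abelian_endo_axioms_def)
qed

sublocale Q: tdlc_abelian_endo "G Mod H" TQ \<phi>Q
  by (rule tdlc_abelian_endo_quotient)

lemma iterate_\<phi>Q: "x \<in> carrier G \<Longrightarrow> (\<phi>Q ^^ k) (\<pi> x) = \<pi> ((\<phi> ^^ k) x)"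
  by (induction k) (simp_all add: \<phi>Q_\<pi> iterate_closed)

lemma image_cotrajectory_subset: "\<pi> ` cotrajectory T \<phi> U n \<subseteq> cotrajectory TQ \<phi>Q (\<pi> ` U) n"
  by (auto simp: cotrajectory_def topspace_eq topspace_Q carrier_Q iterate_\<phi>Q)

text \<open>
  The heart of the inequality that bounds the entropy from above.  Let the coset of \<open>x\<close> stay in
  \<open>\<pi> ` U\<close> up to time \<open>n\<close>, say \<open>\<phi>\<^sup>k(x) = u k \<cdot> h k\<close> with \<open>u k \<in> U\<close> and \<open>h k \<in> H\<close>.  Then
  \<open>h (k + 1) = \<phi>(h k) \<cdot> b k\<close> where \<open>b k = \<phi>(u k) / u (k + 1)\<close> is close to the identity and lies in
  \<open>H\<close>.  Hence \<open>h\<close> differs from a small solution \<open>w\<close> of the same recursion by a true orbit in \<open>H\<close>,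
  that of \<open>g = h 0 / w 0\<close>, and \<open>x / g\<close> is in the same coset as \<open>x\<close> and has the orbit
  \<open>u k \<cdot> w k\<close>, which stays in \<open>L\<close>.
\<close>

lemma cotrajectory_quotient_subset:
  assumes L: "L \<in> compact_open_subgroups G T"
  obtains U where "U \<in> compact_open_subgroups G T" "U \<subseteq> L"
    "\<And>n. n > 0 \<Longrightarrow> cotrajectory TQ \<phi>Q (\<pi> ` U) n \<subseteq> \<pi> ` cotrajectory T \<phi> L n"
proof -
  have sL: "subgroup L G"
    using L by (simp add: compact_open_subgroups_def)
  obtain V where V: "V \<in> compact_open_subgroups (G\<lparr>carrier := H\<rparr>) (subtopology T H)" "V \<subseteq> L \<inter> H"
    and split: "\<And>m x. x \<in> V \<Longrightarrow> \<exists>y z. y \<in> carrier (G\<lparr>carrier := H\<rparr>) \<and> z \<in> carrier (G\<lparr>carrier := H\<rparr>)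
        \<and> x = (restrict \<phi> H ^^ m) y \<otimes>\<^bsub>G\<lparr>carrier := H\<rparr>\<^esub> z \<and>
        (\<forall>i\<le>m. (restrict \<phi> H ^^ i) y \<in> V \<and> (restrict \<phi> H ^^ i) z \<in> V)"
    using Sub.exists_factorizing_subgroup[OF compact_open_subgroups_Int_H[OF L]] by metis
  have sV: "subgroup V (G\<lparr>carrier := H\<rparr>)"
    using V by (simp add: compact_open_subgroups_def)
  obtain B where B: "B \<in> compact_open_subgroups G T" "B \<inter> H \<subseteq> V"
    using open_subgroup_of_H V(1) by (auto simp: compact_open_subgroups_def)
  then have sB: "subgroup B G" "openin T B"
    by (auto simp: compact_open_subgroups_def)
  \<comment> \<open>An element \<open>u\<close> of the cotrajectory of length 2 has both \<open>u\<close> and \<open>\<phi> u\<close> in \<open>B\<close>.\<close>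
  have "openin T (L \<inter> cotrajectory T \<phi> B 2)"
    using L cotrajectory_openin[OF sB(2)] by (auto simp: compact_open_subgroups_def)
  moreover have "\<one> \<in> L \<inter> cotrajectory T \<phi> B 2"
    using subgroup.one_closed[OF sL] subgroup.one_closed[OF cotrajectory_subgroup[OF sB(1)]] by simp
  ultimately obtain U where U: "U \<in> compact_open_subgroups G T" "U \<subseteq> L \<inter> cotrajectory T \<phi> B 2"
    using compact_open_subgroup_base by metis
  have UB: "u \<in> L" "u \<in> B" "\<phi> u \<in> B" "u \<in> carrier G" if "u \<in> U" for u
    using U(2) that subgroup.mem_carrier[OF sL] unfolding numeral_2_eq_2 cotrajectory_Suc by auto
  show thesis
  proof (rule that[OF U(1)])
    show "U \<subseteq> L"
      using U(2) by auto
    fix n :: nat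
    assume n: "n > 0"
    show "cotrajectory TQ \<phi>Q (\<pi> ` U) n \<subseteq> \<pi> ` cotrajectory T \<phi> L n"
    proof
      fix X
      assume X: "X \<in> cotrajectory TQ \<phi>Q (\<pi> ` U) n"
      then obtain x where x: "x \<in> carrier G" "X = \<pi> x"
        by (auto simp: cotrajectory_def topspace_Q carrier_Q)
      have xc: "(\<phi> ^^ k) x \<in> carrier G" for k
        using iterate_closed[OF x(1)] .
      have "\<forall>k. \<exists>u. k < n \<longrightarrow> u \<in> U \<and> inv u \<otimes> (\<phi> ^^ k) x \<in> H"
      proof
        fix k
        show "\<exists>u. k < n \<longrightarrow> u \<in> U \<and> inv u \<otimes> (\<phi> ^^ k) x \<in> H"
        proof (cases "k < n")
          case True
          then have "\<pi> ((\<phi> ^^ k) x) \<in> \<pi> ` U"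
            using X x iterate_\<phi>Q by (auto simp: cotrajectory_def)
          then obtain u where u: "u \<in> U" "\<pi> u = \<pi> ((\<phi> ^^ k) x)"
            by auto
          then show ?thesis
            using \<pi>_eq_iff[OF UB(4)[OF u(1)] xc] by auto
        qed simp
      qed
      then obtain u where u: "\<And>k. k < n \<Longrightarrow> u k \<in> U" and uH: "\<And>k. k < n \<Longrightarrow> inv (u k) \<otimes> (\<phi> ^^ k) x \<in> H"
        using choice by metis
      define h where "h k = inv (u k) \<otimes> (\<phi> ^^ k) x" for k
      have hH: "h k \<in> H" and hc: "h k \<in> carrier G" and uc: "u k \<in> carrier G" if "k < n" for k
        using uH[OF that] mem_H_carrier UB(4)[OF u[OF that]] by (auto simp: h_def)
      have xk: "(\<phi> ^^ k) x = u k \<otimes> h k" if "k < n" for k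
        using uc[OF that] xc by (simp add: h_def m_assoc[symmetric])
      define b where "b k = h (Suc k) \<otimes> inv (\<phi> (h k))" for k
      have bV: "b k \<in> V" if k: "k < n - 1" for k
      proof -
        have k': "k < n" "Suc k < n"
          using k by auto
        have "u (Suc k) \<otimes> h (Suc k) = \<phi> (u k) \<otimes> \<phi> (h k)"
          using xk[OF k'(1)] xk[OF k'(2)] uc[OF k'(1)] hc[OF k'(1)] by (simp add: endo_mult)
        then have "h (Suc k) = inv (u (Suc k)) \<otimes> (\<phi> (u k) \<otimes> \<phi> (h k))"
          using uc[OF k'(1)] uc[OF k'(2)] hc[OF k'(1)] hc[OF k'(2)] endo_closed
          by (simp add: inv_solve_left)
        then have "b k = inv (u (Suc k)) \<otimes> (\<phi> (u k) \<otimes> (\<phi> (h k) \<otimes> inv (\<phi> (h k))))"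
          using uc[OF k'(1)] uc[OF k'(2)] hc[OF k'(1)] endo_closed by (simp add: b_def m_assoc)
        then have "b k = \<phi> (u k) \<otimes> inv (u (Suc k))"
          using uc[OF k'(1)] uc[OF k'(2)] hc[OF k'(1)] endo_closed by (simp add: m_comm)
        also have "\<dots> \<in> B"
          using UB u[OF k'(1)] u[OF k'(2)] sB(1) by (simp add: subgroup.m_closed subgroup.m_inv_closed)
        finally have "b k \<in> B" .
        moreover have "b k \<in> H"
          unfolding b_def using hH[OF k'(1)] hH[OF k'(2)] invariant_H subgroup_H
          by (auto intro!: subgroup.m_closed subgroup.m_inv_closed)
        ultimately show ?thesis
          using B(2) by auto
      qed
      obtain w where w: "(\<forall>k\<le>n - 1. w k \<in> V)
          \<and> (\<forall>k<n - 1. w (Suc k) = restrict \<phi> H (w k) \<otimes>\<^bsub>G\<lparr>carrier := H\<rparr>\<^esub> b k)"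
        using Sub.perturbed_orbit_in_subgroup[OF sV split bV] by (rule exE)
      note wV = w[THEN conjunct1, rule_format] and wS = w[THEN conjunct2, rule_format]
      have wLH: "w k \<in> L \<inter> H" if "k < n" for k
        using wV[of k] V(2) that by auto
      then have wH: "w k \<in> H" and wL: "w k \<in> L" and wc: "w k \<in> carrier G" if "k < n" for k
        using that mem_H_carrier by auto
      define g where "g = h 0 \<otimes> inv (w 0)"
      have gH: "g \<in> H" and gc: "g \<in> carrier G"
        using hH[OF n] wH[OF n] subgroup_H mem_H_carrier
        by (auto simp: g_def subgroup.m_closed subgroup.m_inv_closed)
      have gk: "(\<phi> ^^ k) g = h k \<otimes> inv (w k)" if "k < n" for k
        using that
      proof (induction k)
        case 0
        then show ?case
          by (simp add: g_def)
      next
        case (Suc k)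
        then have k: "k < n" "Suc k < n"
          by auto
        have "w (Suc k) = \<phi> (w k) \<otimes> (h (Suc k) \<otimes> inv (\<phi> (h k)))"
          using wS[of k] k wH[OF k(1)] by (simp add: b_def)
        moreover have "(\<phi> ^^ Suc k) g = \<phi> (h k) \<otimes> inv (\<phi> (w k))"
          using Suc.IH[OF k(1)] hc[OF k(1)] wc[OF k(1)] by (simp add: endo_mult endo_inv)
        ultimately show ?case
          using hc[OF k(1)] hc[OF k(2)] wc[OF k(1)] endo_closed by (simp add: divide_mult_divide_cancel)
      qed
      define y where "y = x \<otimes> inv g"
      have yc: "y \<in> carrier G"
        using x(1) gc by (simp add: y_def)
      have "(\<phi> ^^ k) y \<in> L" if k: "k < n" for k
      proof -
        have "(\<phi> ^^ k) (inv g) = inv ((\<phi> ^^ k) g)"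
          using group_hom.hom_inv[of G G "\<phi> ^^ k" g] hom_iterate[of k] gc
          by (simp add: group_hom_def group_hom_axioms_def)
        then have "(\<phi> ^^ k) y = u k \<otimes> h k \<otimes> inv (h k \<otimes> inv (w k))"
          using x(1) gc xk[OF k] gk[OF k] by (simp add: y_def iterate_mult)
        also have "\<dots> = u k \<otimes> w k"
          using uc[OF k] hc[OF k] wc[OF k] by (simp add: mult_divide_divide_cancel)
        also have "\<dots> \<in> L"
          using UB(1)[OF u[OF k]] wL[OF k] sL by (simp add: subgroup.m_closed)
        finally show ?thesis .
      qed
      then have "y \<in> cotrajectory T \<phi> L n"
        using yc by (simp add: cotrajectory_def topspace_eq)
      moreover have "\<pi> y = \<pi> x"
      proof -
        have "inv y \<otimes> x = g"
          using x(1) gc by (simp add: y_def inv_mult_group m_assoc)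
        then show ?thesis
          using \<pi>_eq_iff[OF yc x(1)] gH by simp
      qed
      ultimately show "X \<in> \<pi> ` cotrajectory T \<phi> L n"
        using x(2) by (metis imageI)
    qed
  qed
qed

section \<open>The addition theorem for abelian groups\<close>

lemma subgroup_index_cotrajectory_split:
  assumes U: "U \<in> compact_open_subgroups G T" and n: "n > 0"
  shows "subgroup_index G U (cotrajectory T \<phi> U n)
       = subgroup_index (G\<lparr>carrier := H\<rparr>) (U \<inter> H)
           (cotrajectory (subtopology T H) (restrict \<phi> H) (U \<inter> H) n)
         * subgroup_index (G Mod H) (\<pi> ` U) (\<pi> ` cotrajectory T \<phi> U n)"
  unfolding cotrajectory_Int_H using U subgroup_H cotrajectory_subgroup cotrajectory_subset[OF n, of T \<phi> U]
  by (intro subgroup_index_split) (auto simp: compact_open_subgroups_def)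

text \<open>
  The index of the cotrajectory of \<open>U\<close> splits into a factor in \<open>H\<close>, the index of the cotrajectory of
  \<open>U \<inter> H\<close>, and a factor in the quotient, which is at least the index of the cotrajectory of
  \<open>\<pi> ` U\<close> because the image of a cotrajectory is contained in the cotrajectory of the image.
\<close>

lemma growth_rate_ge_add:
  assumes U: "U \<in> compact_open_subgroups G T"
  shows "Sub.growth_rate (U \<inter> H) + Q.growth_rate (\<pi> ` U) \<le> growth_rate U"
proof -
  note UH = compact_open_subgroups_Int_H[OF U] and UQ = compact_open_subgroups_image_\<pi>[OF U]
  let ?a = "\<lambda>n. subgroup_index (G\<lparr>carrier := H\<rparr>) (U \<inter> H)
      (cotrajectory (subtopology T H) (restrict \<phi> H) (U \<inter> H) n)"
  let ?b = "\<lambda>n. subgroup_index (G Mod H) (\<pi> ` U) (cotrajectory TQ \<phi>Q (\<pi> ` U) n)"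
  have pos: "?a n > 0" "?b n > 0" for n
    using UH UQ by (auto intro!: Sub.subgroup_index_pos Q.subgroup_index_pos
        Sub.cotrajectory_subgroup Sub.cotrajectory_openin Q.cotrajectory_subgroup
        Q.cotrajectory_openin simp: compact_open_subgroups_def)
  have "(\<lambda>n. ln (real (?a n * ?b n)) / real n)
      \<longlonglongrightarrow> Sub.growth_rate (U \<inter> H) + Q.growth_rate (\<pi> ` U)"
    using tendsto_add[OF Sub.growth_rate_LIMSEQ[OF UH] Q.growth_rate_LIMSEQ[OF UQ]] pos
    by (simp add: ln_mult add_divide_distrib)
  then show ?thesis
  proof (rule growth_rate_le[OF _ growth_rate_LIMSEQ[OF U]])
    fix n :: nat
    assume n: "n > 0"
    show "0 < ?a n * ?b n"
      using pos by simp
    have "\<pi> ` cotrajectory T \<phi> U n \<in> compact_open_subgroups (G Mod H) TQ"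
      using cotrajectory_in_compact_open_subgroups[OF U n] by (rule compact_open_subgroups_image_\<pi>)
    then have "?b n \<le> subgroup_index (G Mod H) (\<pi> ` U) (\<pi> ` cotrajectory T \<phi> U n)"
      using UQ image_cotrajectory_subset cotrajectory_subset[OF n, of TQ \<phi>Q "\<pi> ` U"]
      by (intro Q.subgroup_index_antimono(2) Q.subgroup_index_pos)
        (auto simp: compact_open_subgroups_def Q.cotrajectory_subgroup)
    then show "?a n * ?b n \<le> 1 * subgroup_index G U (cotrajectory T \<phi> U n)"
      unfolding subgroup_index_cotrajectory_split[OF U n] by simp
  qed
qed

text \<open>
  By the shadowing lemma, the factor in the quotient of the index of the cotrajectory of \<open>L\<close> is at
  most the index of the cotrajectory of \<open>\<pi> ` U\<close>, times the constant index of \<open>\<pi> ` U\<close> in \<open>\<pi> ` L\<close>.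
\<close>

lemma growth_rate_le_add:
  assumes L: "L \<in> compact_open_subgroups G T"
  obtains U where "U \<in> compact_open_subgroups G T"
    "growth_rate L \<le> Sub.growth_rate (L \<inter> H) + Q.growth_rate (\<pi> ` U)"
proof -
  obtain U where U: "U \<in> compact_open_subgroups G T" "U \<subseteq> L"
    and CU: "\<And>n. n > 0 \<Longrightarrow> cotrajectory TQ \<phi>Q (\<pi> ` U) n \<subseteq> \<pi> ` cotrajectory T \<phi> L n"
    by (rule cotrajectory_quotient_subset[OF L]) blast
  note LH = compact_open_subgroups_Int_H[OF L] and LQ = compact_open_subgroups_image_\<pi>[OF L]
    and UQ = compact_open_subgroups_image_\<pi>[OF U(1)]
  let ?a = "\<lambda>n. subgroup_index (G\<lparr>carrier := H\<rparr>) (L \<inter> H)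
      (cotrajectory (subtopology T H) (restrict \<phi> H) (L \<inter> H) n)"
  let ?b = "\<lambda>n. subgroup_index (G Mod H) (\<pi> ` U) (cotrajectory TQ \<phi>Q (\<pi> ` U) n)"
  have pos: "?a n > 0" "?b n > 0" for n
    using LH UQ by (auto intro!: Sub.subgroup_index_pos Q.subgroup_index_pos
        Sub.cotrajectory_subgroup Sub.cotrajectory_openin Q.cotrajectory_subgroup
        Q.cotrajectory_openin simp: compact_open_subgroups_def)
  have lim: "(\<lambda>n. ln (real (?a n * ?b n)) / real n)
      \<longlonglongrightarrow> Sub.growth_rate (L \<inter> H) + Q.growth_rate (\<pi> ` U)"
    using tendsto_add[OF Sub.growth_rate_LIMSEQ[OF LH] Q.growth_rate_LIMSEQ[OF UQ]] pos
    by (simp add: ln_mult add_divide_distrib)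
  have "growth_rate L \<le> Sub.growth_rate (L \<inter> H) + Q.growth_rate (\<pi> ` U)"
  proof (rule growth_rate_le[OF growth_rate_LIMSEQ[OF L] lim])
    fix n :: nat
    assume n: "n > 0"
    show "0 < subgroup_index G L (cotrajectory T \<phi> L n)"
      using L by (intro subgroup_index_pos)
        (auto simp: compact_open_subgroups_def cotrajectory_subgroup cotrajectory_openin)
    let ?D = "cotrajectory TQ \<phi>Q (\<pi> ` U) n"
    have D: "?D \<in> compact_open_subgroups (G Mod H) TQ"
      by (rule Q.cotrajectory_in_compact_open_subgroups[OF UQ n])
    have C: "\<pi> ` cotrajectory T \<phi> L n \<in> compact_open_subgroups (G Mod H) TQ"
      using cotrajectory_in_compact_open_subgroups[OF L n] by (rule compact_open_subgroups_image_\<pi>)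
    have "subgroup_index (G Mod H) (\<pi> ` L) (\<pi> ` cotrajectory T \<phi> L n)
        \<le> subgroup_index (G Mod H) (\<pi> ` L) ?D"
      using LQ C D CU[OF n] cotrajectory_subset[OF n, of T \<phi> L]
      by (intro Q.subgroup_index_antimono(2) Q.subgroup_index_pos)
        (auto simp: compact_open_subgroups_def)
    also have "\<dots> = subgroup_index (G Mod H) (\<pi> ` L) (\<pi> ` U) * ?b n"
      using LQ UQ D U(2) cotrajectory_subset[OF n, of TQ \<phi>Q "\<pi> ` U"]
      by (intro Q.subgroup_index_mult) (auto simp: compact_open_subgroups_def)
    finally show "subgroup_index G L (cotrajectory T \<phi> L n)
        \<le> subgroup_index (G Mod H) (\<pi> ` L) (\<pi> ` U) * (?a n * ?b n)"
      unfolding subgroup_index_cotrajectory_split[OF L n] by (simp add: mult.left_commute)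
  qed
  then show thesis
    using that U(1) by blast
qed

lemma common_refinement:
  assumes A: "A \<in> compact_open_subgroups (G\<lparr>carrier := H\<rparr>) (subtopology T H)"
    and B: "B \<in> compact_open_subgroups (G Mod H) TQ"
  obtains U where "U \<in> compact_open_subgroups G T" "U \<inter> H \<subseteq> A" "\<pi> ` U \<subseteq> B"
proof -
  obtain A' where A': "A' \<in> compact_open_subgroups G T" "A' \<inter> H \<subseteq> A"
    using open_subgroup_of_H[of A] A by (auto simp: compact_open_subgroups_def)
  let ?B' = "{x \<in> carrier G. \<pi> x \<in> B}"
  have "openin T (A' \<inter> ?B')"
    using A' B by (auto simp: compact_open_subgroups_def openin_Q_iff)
  moreover have "\<one> \<in> A' \<inter> ?B'"
    using A' B subgroup.one_closed[of A' G] subgroup.one_closed[of B "G Mod H"]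
      group_hom.hom_one[OF group_hom_\<pi>] by (simp add: compact_open_subgroups_def)
  ultimately obtain U where "U \<in> compact_open_subgroups G T" "U \<subseteq> A' \<inter> ?B'"
    using compact_open_subgroup_base by metis
  then show thesis
    using A'(2) by (intro that[of U]) auto
qed

text \<open>
  Growth rates increase as the subgroup shrinks, and a subgroup of \<open>G\<close> can be chosen to refine given
  ones in \<open>H\<close> and in the quotient at the same time; this turns the sum of two suprema into a supremum
  of sums.
\<close>

theorem addition_theorem:
  assumes M: "left_haar_measure G T M"
    and MH: "left_haar_measure (G\<lparr>carrier := H\<rparr>) (subtopology T H) MH"
    and MQ: "left_haar_measure (G Mod H) TQ MQ"
  shows "top_entropy G T M \<phi>
       = top_entropy (G\<lparr>carrier := H\<rparr>) (subtopology T H) MH (restrict \<phi> H)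
       + top_entropy (G Mod H) TQ MQ \<phi>Q"
proof -
  let ?S = "compact_open_subgroups G T"
    and ?SH = "compact_open_subgroups (G\<lparr>carrier := H\<rparr>) (subtopology T H)"
    and ?SQ = "compact_open_subgroups (G Mod H) TQ"
  let ?h = "SUP U\<in>?S. ereal (growth_rate U)"
    and ?hH = "SUP A\<in>?SH. ereal (Sub.growth_rate A)"
    and ?hQ = "SUP B\<in>?SQ. ereal (Q.growth_rate B)"
  have "?h \<le> ?hH + ?hQ"
  proof (rule SUP_least)
    fix L
    assume L: "L \<in> ?S"
    then obtain U where U: "U \<in> ?S"
      "growth_rate L \<le> Sub.growth_rate (L \<inter> H) + Q.growth_rate (\<pi> ` U)"
      by (rule growth_rate_le_add)
    then have "ereal (growth_rate L) \<le> ereal (Sub.growth_rate (L \<inter> H)) + ereal (Q.growth_rate (\<pi> ` U))"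
      by simp
    also have "\<dots> \<le> ?hH + ?hQ"
      using compact_open_subgroups_Int_H[OF L] compact_open_subgroups_image_\<pi>[OF U(1)]
      by (intro add_mono SUP_upper)
    finally show "ereal (growth_rate L) \<le> ?hH + ?hQ" .
  qed
  moreover have "?hH + ?hQ \<le> ?h"
  proof -
    have hH: "?hH \<noteq> -\<infinity>"
    proof -
      obtain A where "A \<in> ?SH"
        using Sub.compact_open_subgroups_nonempty by blast
      then have "ereal (Sub.growth_rate A) \<le> ?hH"
        by (rule SUP_upper)
      then show ?thesis
        by auto
    qed
    have "?hH + ereal (Q.growth_rate B) \<le> ?h" if B: "B \<in> ?SQ" for B
    proof -
      have "ereal (Sub.growth_rate A) + ereal (Q.growth_rate B) \<le> ?h" if A: "A \<in> ?SH" for A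
      proof -
        obtain U where U: "U \<in> ?S" "U \<inter> H \<subseteq> A" "\<pi> ` U \<subseteq> B"
          by (rule common_refinement[OF A B])
        have "Sub.growth_rate A + Q.growth_rate B \<le> Sub.growth_rate (U \<inter> H) + Q.growth_rate (\<pi> ` U)"
          using Sub.growth_rate_antimono[OF A compact_open_subgroups_Int_H[OF U(1)] U(2)]
            Q.growth_rate_antimono[OF B compact_open_subgroups_image_\<pi>[OF U(1)] U(3)] by simp
        also have "\<dots> \<le> growth_rate U"
          by (rule growth_rate_ge_add[OF U(1)])
        finally show ?thesis
          using U(1) by (intro SUP_upper2[of U]) auto
      qed
      then show ?thesis
        using Sub.compact_open_subgroups_nonempty
        by (subst SUP_ereal_add_left[symmetric]) (auto intro: SUP_least)
    qed
    then show ?thesis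
      using Q.compact_open_subgroups_nonempty hH
      by (subst SUP_ereal_add_right[symmetric]) (auto intro: SUP_least)
  qed
  ultimately show ?thesis
    unfolding top_entropy_eq_SUP[OF M] Sub.top_entropy_eq_SUP[OF MH] Q.top_entropy_eq_SUP[OF MQ]
    by (rule antisym)
qed

end

section \<open>The topological group of vectors over the p-adic numbers\<close>

lemma padic_seq_abs_ultrametric: "padic_seq_abs (s + r) \<le> max (padic_seq_abs s) (padic_seq_abs r)"
  by (intro LIMSEQ_le[OF padic_seq_abs_LIMSEQ
        tendsto_max[OF padic_seq_abs_LIMSEQ[of s] padic_seq_abs_LIMSEQ[of r]]])
     (auto simp: plus_padic_seq.rep_eq intro: padic_abs_ultrametric[OF prime_card])

lemma dist_padic_0_add: "dist (x + y) 0 \<le> max (dist x 0) (dist y (0 :: 'p::prime_card padic))"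
  by transfer (use padic_seq_abs_ultrametric in simp)

lemma dist_padic_0_minus [simp]: "dist (- x) 0 = dist x (0 :: 'p::prime_card padic)"
  by transfer simp

lemma dist_padic_diff: "dist x y = dist (x - y) (0 :: 'p::prime_card padic)"
  by transfer simp

lemma group_padic_group: "group (padic_group :: 'p::prime_card padic monoid)"
proof (rule groupI)
  fix x :: "'p padic"
  show "\<exists>y\<in>carrier padic_group. y \<otimes>\<^bsub>padic_group\<^esub> x = \<one>\<^bsub>padic_group\<^esub>"
    by (intro bexI[of _ "- x"]) (simp_all add: padic_group_def)
qed (simp_all add: padic_group_def add.assoc)

lemma inv_padic_group: "inv\<^bsub>padic_group\<^esub> x = - (x :: 'p::prime_card padic)"
  by (rule group.inv_equality[OF group_padic_group]) (simp_all add: padic_group_def)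

lemma carrier_padic_power_group: "carrier (padic_power_group n) = (\<Pi>\<^sub>E i\<in>{..<n}. UNIV)"
  by (simp add: padic_power_group_def padic_group_def)

lemma mult_padic_power_group: "x \<otimes>\<^bsub>padic_power_group n\<^esub> y = (\<lambda>i\<in>{..<n}. x i + y i)"
  by (simp add: padic_power_group_def padic_group_def)

lemma comm_group_padic_power_group:
  "comm_group (padic_power_group n :: (nat \<Rightarrow> 'p::prime_card padic) monoid)"
proof (rule group.group_comm_groupI)
  show "group (padic_power_group n :: (nat \<Rightarrow> 'p padic) monoid)"
    unfolding padic_power_group_def by (intro product_group group_padic_group)
qed (simp add: mult_padic_power_group add.commute)

text \<open>
  By the ultrametric inequality these are subgroups; they form a base of neighbourhoods of 0.
\<close>

definition polyball :: "nat \<Rightarrow> real \<Rightarrow> (nat \<Rightarrow> 'p::prime_card padic) set" where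
  "polyball n e = (\<Pi>\<^sub>E i\<in>{..<n}. ball 0 e)"

lemma subgroup_polyball:
  assumes "e > 0"
  shows "subgroup (polyball n e) (padic_power_group n :: (nat \<Rightarrow> 'p::prime_card padic) monoid)"
proof
  show "polyball n e \<subseteq> carrier (padic_power_group n)"
    by (auto simp: polyball_def carrier_padic_power_group)
  show "\<one>\<^bsub>padic_power_group n\<^esub> \<in> (polyball n e :: (nat \<Rightarrow> 'p padic) set)"
    using assms by (auto simp: polyball_def padic_power_group_def padic_group_def)
next
  fix x y :: "nat \<Rightarrow> 'p padic"
  assume xy: "x \<in> polyball n e" "y \<in> polyball n e"
  have "dist (x i + y i) 0 < e" if "i < n" for i
  proof -
    have "dist (x i) 0 < e" "dist (y i) 0 < e"
      using xy that by (auto simp: polyball_def PiE_iff dist_commute)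
    then show ?thesis
      by (intro le_less_trans[OF dist_padic_0_add]) simp
  qed
  then show "x \<otimes>\<^bsub>padic_power_group n\<^esub> y \<in> polyball n e"
    by (auto simp: mult_padic_power_group polyball_def dist_commute)
next
  fix x :: "nat \<Rightarrow> 'p padic"
  assume x: "x \<in> polyball n e"
  have "inv\<^bsub>padic_power_group n\<^esub> x = (\<lambda>i\<in>{..<n}. - x i)"
    using x group_padic_group inv_product_group[of x "{..<n}" "\<lambda>_. padic_group :: 'p padic monoid"]
    by (simp add: padic_power_group_def polyball_def PiE_iff padic_group_def[THEN arg_cong[of _ _ carrier]]
        inv_padic_group)
  then show "inv\<^bsub>padic_power_group n\<^esub> x \<in> polyball n e"
    using x dist_padic_0_minus by (auto simp: polyball_def dist_commute[of 0] PiE_iff)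
qed

text \<open>
  The metric is translation invariant, so translates of balls are balls.
\<close>

lemma lcoset_polyball:
  fixes x :: "nat \<Rightarrow> 'p::prime_card padic"
  assumes "x \<in> carrier (padic_power_group n)"
  shows "x <#\<^bsub>padic_power_group n\<^esub> polyball n e = (\<Pi>\<^sub>E i\<in>{..<n}. ball (x i) e)"
proof (intro subset_antisym subsetI)
  fix y
  assume "y \<in> x <#\<^bsub>padic_power_group n\<^esub> polyball n e"
  then obtain z where z: "z \<in> polyball n e" "y = (\<lambda>i\<in>{..<n}. x i + z i)"
    by (auto simp: l_coset_def mult_padic_power_group)
  have "dist (x i) (x i + z i) < e" if "i < n" for i
    using z(1) that dist_padic_diff[of "x i" "x i + z i"] dist_padic_0_minus[of "z i"]
    by (auto simp: polyball_def PiE_iff dist_commute)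
  then show "y \<in> (\<Pi>\<^sub>E i\<in>{..<n}. ball (x i) e)"
    by (auto simp: z(2))
next
  fix y
  assume y: "y \<in> (\<Pi>\<^sub>E i\<in>{..<n}. ball (x i) e)"
  define z where "z = (\<lambda>i\<in>{..<n}. y i - x i)"
  have "dist 0 (y i - x i) < e" if "i < n" for i
  proof -
    have "dist (x i) (y i) < e"
      using y that by (auto simp: PiE_iff)
    then show ?thesis
      using dist_padic_diff[of "y i" "x i"] by (simp add: dist_commute)
  qed
  then have "z \<in> polyball n e"
    by (auto simp: polyball_def z_def)
  moreover have "y = x \<otimes>\<^bsub>padic_power_group n\<^esub> z"
    using y by (auto simp: mult_padic_power_group z_def PiE_iff extensional_def fun_eq_iff)
  ultimately show "y \<in> x <#\<^bsub>padic_power_group n\<^esub> polyball n e"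
    by (auto simp: l_coset_def)
qed

lemma openin_lcoset_polyball:
  fixes x :: "nat \<Rightarrow> 'p::prime_card padic"
  assumes "x \<in> carrier (padic_power_group n)"
  shows "openin (padic_power_topology n) (x <#\<^bsub>padic_power_group n\<^esub> polyball n e)"
  unfolding lcoset_polyball[OF assms] padic_power_topology_def by (simp add: openin_PiE)

lemma polyball_base:
  fixes x :: "nat \<Rightarrow> 'p::prime_card padic"
  assumes "openin (padic_power_topology n) W" "x \<in> W"
  obtains e where "e > 0" "x <#\<^bsub>padic_power_group n\<^esub> polyball n e \<subseteq> W"
proof -
  have "\<exists>U. (\<forall>i\<in>{..<n}. openin euclidean (U i)) \<and> x \<in> Pi\<^sub>E {..<n} U \<and> Pi\<^sub>E {..<n} U \<subseteq> W"
    using assms unfolding padic_power_topology_def openin_product_topology_alt by blast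
  then obtain U where U': "(\<forall>i\<in>{..<n}. openin euclidean (U i)) \<and> x \<in> Pi\<^sub>E {..<n} U \<and> Pi\<^sub>E {..<n} U \<subseteq> W"
    by (rule exE)
  then have U: "\<And>i. i < n \<Longrightarrow> open (U i)" "x \<in> Pi\<^sub>E {..<n} U" "Pi\<^sub>E {..<n} U \<subseteq> W"
    by simp_all
  have xG: "x \<in> carrier (padic_power_group n)"
    using U(2) by (auto simp: carrier_padic_power_group PiE_iff)
  have "\<forall>i\<in>{..<n}. \<forall>\<^sub>F e in at_right 0. ball (x i) e \<subseteq> U i"
  proof
    fix i
    assume i: "i \<in> {..<n}"
    then have "open (U i)" "x i \<in> U i"
      using U(1,2) by (auto simp: PiE_iff)
    then obtain d where d: "d > 0" "ball (x i) d \<subseteq> U i"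
      using open_contains_ball by blast
    show "\<forall>\<^sub>F e in at_right 0. ball (x i) e \<subseteq> U i"
      using eventually_at_right_real[OF d(1)]
      by eventually_elim (use d(2) in \<open>auto simp: subset_iff\<close>)
  qed
  then have "\<forall>\<^sub>F e in at_right 0. \<forall>i\<in>{..<n}. ball (x i) e \<subseteq> U i"
    by (simp add: eventually_ball_finite_distrib)
  then have "\<forall>\<^sub>F e in at_right 0. (0::real) < e \<and> (\<forall>i\<in>{..<n}. ball (x i) e \<subseteq> U i)"
    by (rule eventually_conj[OF eventually_at_right_less])
  then have "\<exists>e>0. \<forall>i\<in>{..<n}. ball (x i) e \<subseteq> U i"
    by (rule eventually_happens'[rotated]) simp
  then obtain e where e: "e > 0" "\<And>i. i < n \<Longrightarrow> ball (x i) e \<subseteq> U i"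
    by auto
  have "x <#\<^bsub>padic_power_group n\<^esub> polyball n e \<subseteq> Pi\<^sub>E {..<n} U"
    unfolding lcoset_polyball[OF xG] using e(2) by (intro PiE_mono) simp
  then show thesis
    using that[OF e(1)] U(3) by blast
qed

lemma nonarchimedean_group_padic_power:
  "nonarchimedean_group (padic_power_group n) (padic_power_topology n :: (nat \<Rightarrow> 'p::prime_card padic) topology)"
proof -
  let ?G = "padic_power_group n :: (nat \<Rightarrow> 'p padic) monoid"
    and ?T = "padic_power_topology n :: (nat \<Rightarrow> 'p padic) topology"
  interpret G: comm_group ?G
    by (rule comm_group_padic_power_group)
  show ?thesis
  proof (intro nonarchimedean_group.intro nonarchimedean_group_axioms.intro G.comm_group_axioms)
    show "topspace ?T = carrier ?G"
      by (simp add: padic_power_topology_def carrier_padic_power_group)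
  next
    fix W x
    assume W: "openin ?T W" "x \<in> W"
    obtain e where e: "e > 0" "x <#\<^bsub>?G\<^esub> polyball n e \<subseteq> W"
      by (rule polyball_base[OF W])
    have "openin ?T (polyball n e)"
      using openin_lcoset_polyball[of "\<one>\<^bsub>?G\<^esub>" n e] G.lcos_mult_one[OF subgroup.subset[OF subgroup_polyball[OF e(1)]]]
      by simp
    then show "\<exists>B. subgroup B ?G \<and> openin ?T B \<and> x <#\<^bsub>?G\<^esub> B \<subseteq> W"
      using e subgroup_polyball by blast
  next
    fix B x
    assume B: "subgroup B ?G" "openin ?T B" and x: "x \<in> carrier ?G"
    obtain e where e: "e > 0" "\<one>\<^bsub>?G\<^esub> <#\<^bsub>?G\<^esub> polyball n e \<subseteq> B"
      by (rule polyball_base[OF B(2) subgroup.one_closed[OF B(1)]])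
    have eB: "polyball n e \<subseteq> B"
      using e(2) G.lcos_mult_one[OF subgroup.subset[OF subgroup_polyball[OF e(1)]]] by simp
    have xB: "x <#\<^bsub>?G\<^esub> B \<subseteq> carrier ?G"
      by (rule G.l_coset_subset_G[OF subgroup.subset[OF B(1)] x])
    show "openin ?T (x <#\<^bsub>?G\<^esub> B)"
      unfolding openin_subopen[of _ "x <#\<^bsub>?G\<^esub> B"]
    proof
      fix y
      assume y: "y \<in> x <#\<^bsub>?G\<^esub> B"
      then have yG: "y \<in> carrier ?G"
        using xB by blast
      have "y <#\<^bsub>?G\<^esub> polyball n e \<subseteq> y <#\<^bsub>?G\<^esub> B"
        using eB by (auto simp: l_coset_def)
      also have "\<dots> = x <#\<^bsub>?G\<^esub> B"
        using G.l_repr_independence[OF y x B(1)] by simp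
      finally show "\<exists>W. openin ?T W \<and> y \<in> W \<and> W \<subseteq> x <#\<^bsub>?G\<^esub> B"
        using openin_lcoset_polyball[OF yG] G.mem_lcoset_self[OF subgroup_polyball[OF e(1)] yG] by blast
    qed
  qed
qed

theorem theorem1p9:
  fixes n :: nat
    and \<phi> :: "(nat \<Rightarrow> 'p::prime_card padic) \<Rightarrow> (nat \<Rightarrow> 'p padic)"
    and H :: "(nat \<Rightarrow> 'p padic) set"
    and \<mu> \<mu>H :: "(nat \<Rightarrow> 'p padic) measure"
    and \<mu>Q :: "(nat \<Rightarrow> 'p padic) set measure"
  defines "G \<equiv> padic_power_group n :: (nat \<Rightarrow> 'p padic) monoid"
    and "T \<equiv> padic_power_topology n :: (nat \<Rightarrow> 'p padic) topology"
  assumes "continuous_endo G T \<phi>"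
    and "subgroup H G"
    and "closedin T H"
    and "\<phi> ` H \<subseteq> H"
    and "left_haar_measure G T \<mu>"
    and "left_haar_measure (G\<lparr>carrier := H\<rparr>) (subtopology T H) \<mu>H"
    and "left_haar_measure (G Mod H) (quotient_topology G T H) \<mu>Q"
  shows "top_entropy G T \<mu> \<phi>
       = top_entropy (G\<lparr>carrier := H\<rparr>) (subtopology T H) \<mu>H (restrict \<phi> H)
       + top_entropy (G Mod H) (quotient_topology G T H) \<mu>Q (induced_endo G H \<phi>)"
proof -
  interpret nonarchimedean_group G T
    unfolding G_def T_def by (rule nonarchimedean_group_padic_power)
  interpret tdlc_abelian_group G T
    by unfold_locales (rule haar_imp_compact_open_subgroups_nonempty, fact)
  interpret tdlc_abelian_invariant_subgroup G T \<phi> H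
    by (intro tdlc_abelian_invariant_subgroup.intro tdlc_abelian_endo.intro
        tdlc_abelian_endo_axioms.intro tdlc_abelian_invariant_subgroup_axioms.intro
        tdlc_abelian_group_axioms) fact+
  show ?thesis
    by (rule addition_theorem) fact+
qed

end
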